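(* The rooted tree $\mathcal{G}$ (nodes at level $\ell$: $\mathcal{T}^{(2)}_{\ell+5}$, root the unique 2-triangulation of the pentagon, parent map $p$) and the rooted tree $\mathcal{H}$ (nodes at level $\ell$: $\mathcal{D}^{(2)}_{\ell+1}$, root $(NE,NE)$, parent map $\pi$) are isomorphic as rooted trees.
   Context: 2-triangulations: vertices of a convex $n$-gon labeled $1,\dots,n$ clockwise, $(a,b)$ with $a<b$ the diagonal joining $a,b$ (labels modulo $n$ when needed); a 2-triangulation is a maximal set of diagonals no three pairwise crossing (crossing = intersecting in interiors); $\mathcal{T}^{(2)}_n$ is their set. Diagonals joining vertices at cyclic distance $2$ are trivial and lie in every 2-triangulation; a 2-triangulation is identified with its set of nontrivial diagonals; $\deg(v)$ is the number of nontrivial diagonals incident to $v$. For $n\ge 6$, $T\in\mathcal{T}^{(2)}_n$, let $r=\max\{a:1\le a\le n-3,(a,a+3)\in T\}$. $p(T)$ is obtained by: deleting $(r,r+3)$; then if $\deg(r+1)=0$ deleting $(r-1,r+2)$, if $\deg(r+2)=0$ deleting $(1,r+1)$, and if both degrees are positive deleting $(j,r+2)$ with $j=\max\{a:1\le a<r,(a,r+2)\in T\}$; then contracting the side $(r+1,r+2)$ (diagonals ending at $r+2$ are moved to end at $r+1$, vertex $r+2$ is removed, labels $b>r+2$ decrease by one). $p(T)\in\mathcal{T}^{(2)}_{n-1}$. Dyck paths: a Dyck path of size $m$ is an $N=(0,1)$, $E=(1,0)$ lattice path from $(0,0)$ to $(m,m)$ never below $y=x$; $\mathcal{D}^{(2)}_m$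 is the set of pairs $(P,Q)$ of such paths with $P$ never below $Q$. Write uniquely $P=NE^{p_m}NE^{p_{m-1}}\cdots NE^{p_1}E$ and $Q=NE^{q_m}\cdots NE^{q_1}E$ with $p_i,q_i\ge 0$, and set $p_{m+1}=p_{m+2}=q_{m+1}=0$, $q_0=0$. For $m\ge 2$ let $s=\min\{j\ge 2: p_jq_j=0\}$ ($2\le s\le m+1$). The parent $\pi(P,Q)=(P',Q')\in\mathcal{D}^{(2)}_{m-1}$ is the pair with $p'_i=p_i$ for $i\le s-2$, $p'_{s-1}=p_{s-1}-1$, $p'_s=p_s+p_{s+1}$, $p'_i=p_{i+1}$ for $s+1\le i\le m-1$; and $q'_i=q_i$ for $i\le s-2$, $q'_{s-1}=q_{s-1}+q_s-1$, $q'_i=q_{i+1}$ for $s\le i\le m-1$ (where $P'=NE^{p'_{m-1}}\cdots NE^{p'_1}E$, $Q'=NE^{q'_{m-1}}\cdots NE^{q'_1}E$). *)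

theory Defs
  imports "HOL-Analysis.Analysis"
begin

text \<open>
  A rooted tree is given by its vertices, its root and the map sending every vertex other than the
  root to its parent. The value of the parent map at the root carries no meaning.
\<close>

record 'v rtree =
  tree_verts :: "'v set"
  tree_root :: 'v
  tree_parent :: "'v \<Rightarrow> 'v"

definition rooted_tree :: "'v rtree \<Rightarrow> bool" where
  "rooted_tree G \<longleftrightarrow>
     tree_root G \<in> tree_verts G \<and>
     (\<forall>v \<in> tree_verts G - {tree_root G}. tree_parent G v \<in> tree_verts G) \<and>
     (\<forall>v \<in> tree_verts G. \<exists>k. (tree_parent G ^^ k) v = tree_root G)"

definition rtree_isomorphic :: "'v rtree \<Rightarrow> 'w rtree \<Rightarrow> bool" where
  "rtree_isomorphic G H \<longleftrightarrow>
     (\<exists>f. bij_betw f (tree_verts G) (tree_verts H) \<and>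
          f (tree_root G) = tree_root H \<and>
          (\<forall>v \<in> tree_verts G - {tree_root G}. f (tree_parent G v) = tree_parent H (f v)))"

definition cyclic_distance :: "nat \<Rightarrow> nat \<times> nat \<Rightarrow> nat" where
  "cyclic_distance n = (\<lambda>(a, b). min (b - a) (n - (b - a)))"

definition diagonals :: "nat \<Rightarrow> (nat \<times> nat) set" where
  "diagonals n = {(a, b). 1 \<le> a \<and> a < b \<and> b \<le> n \<and> 2 \<le> cyclic_distance n (a, b)}"

definition nontrivial :: "nat \<Rightarrow> (nat \<times> nat) set" where
  "nontrivial n = {d \<in> diagonals n. 3 \<le> cyclic_distance n d}"

definition crossing :: "nat \<times> nat \<Rightarrow> nat \<times> nat \<Rightarrow> bool" where
  "crossing = (\<lambda>(a, b) (c, d). a < c \<and> c < b \<and> b < d \<or> c < a \<and> a < d \<and> d < b)"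

text \<open>
  Two diagonals of a convex polygon cross when their interiors meet. The lemma
  \<open>crossing_iff_interiors_meet\<close> below shows that the relation \<^const>\<open>crossing\<close> says exactly this,
  whichever convex polygon, with vertices labelled clockwise, is taken.
\<close>

definition orient :: "complex \<Rightarrow> complex \<Rightarrow> complex \<Rightarrow> real" where
  "orient x y z = Im (cnj (y - x) * (z - x))"

definition convex_polygon :: "nat \<Rightarrow> (nat \<Rightarrow> complex) \<Rightarrow> bool" where
  "convex_polygon n v \<longleftrightarrow>
     (\<forall>i j k. 1 \<le> i \<and> i < j \<and> j < k \<and> k \<le> n \<longrightarrow> orient (v i) (v j) (v k) < 0)"

lemma orient_coords:
  "orient x y z = (Re y - Re x) * (Im z - Im x) - (Im y - Im x) * (Re z - Re x)"
  by (simp add: orient_def algebra_simps)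

lemma orient_sign:
  assumes "convex_polygon n v" "1 \<le> a" "a < b" "b \<le> n" "1 \<le> x" "x \<le> n"
  shows "x < a \<or> b < x \<Longrightarrow> orient (v a) (v b) (v x) < 0"
    and "a < x \<Longrightarrow> x < b \<Longrightarrow> orient (v a) (v b) (v x) > 0"
    and "x = a \<or> x = b \<Longrightarrow> orient (v a) (v b) (v x) = 0"
proof -
  have rot: "orient p q r = orient r p q" and flip: "orient p q r = - orient p r q" for p q r
    by (simp_all add: orient_coords algebra_simps)
  have cw: "orient (v i) (v j) (v k) < 0" if "1 \<le> i" "i < j" "j < k" "k \<le> n" for i j k
    using assms(1) that unfolding convex_polygon_def by blast
  show "x < a \<or> b < x \<Longrightarrow> orient (v a) (v b) (v x) < 0"
    using assms cw[of x a b] cw[of a b x] rot[of "v a" "v b" "v x"] by linarith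
  show "a < x \<Longrightarrow> x < b \<Longrightarrow> orient (v a) (v b) (v x) > 0"
    using assms cw[of a x b] flip[of "v a" "v b" "v x"] by linarith
  show "x = a \<or> x = b \<Longrightarrow> orient (v a) (v b) (v x) = 0"
    by (auto simp: orient_coords)
qed

lemma orient_affine:
  "orient x y ((1 - t) *\<^sub>R z + t *\<^sub>R w) = (1 - t) * orient x y z + t * orient x y w"
  by (simp add: orient_coords algebra_simps)

lemma interiors_meet_if_interleaved:
  assumes "convex_polygon n v" "1 \<le> a" "a < c" "c < b" "b < d" "d \<le> n"
  shows "open_segment (v a) (v b) \<inter> open_segment (v c) (v d) \<noteq> {}"
proof -
  define A B C D where "A = v a" and "B = v b" and "C = v c" and "D = v d"
  note defs = A_def B_def C_def D_def
  define t w p q where "t = orient A B C" and "w = - orient A B D"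
    and "p = - orient C D A" and "q = orient C D B"
  have "t > 0" using orient_sign(2)[OF assms(1), of a b c] assms by (simp add: t_def defs)
  moreover have "w > 0" using orient_sign(1)[OF assms(1), of a b d] assms by (simp add: w_def defs)
  moreover have "p > 0" using orient_sign(1)[OF assms(1), of c d a] assms by (simp add: p_def defs)
  moreover have "q > 0" using orient_sign(2)[OF assms(1), of c d b] assms by (simp add: q_def defs)
  ultimately have pos: "t > 0" "w > 0" "p > 0" "q > 0" by simp_all
  have eq: "t + w = p + q"
    by (simp add: t_def w_def p_def q_def orient_coords algebra_simps)
  have "w * Re C + t * Re D = q * Re A + p * Re B" "w * Im C + t * Im D = q * Im A + p * Im B"
    by (simp_all add: t_def w_def p_def q_def orient_coords algebra_simps)
  then have pt: "w *\<^sub>R C + t *\<^sub>R D = q *\<^sub>R A + p *\<^sub>R B"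
    by (simp add: complex_eq_iff)
  define z where "z = (1 / (t + w)) *\<^sub>R (w *\<^sub>R C + t *\<^sub>R D)"
  have frac: "1 - t / (t + w) = w / (t + w)" "1 - p / (p + q) = q / (p + q)"
    using pos by (simp_all add: field_simps)
  have z1: "z = (1 - t / (t + w)) *\<^sub>R C + (t / (t + w)) *\<^sub>R D"
    unfolding z_def frac by (simp add: scaleR_add_right)
  have z2: "z = (1 - p / (p + q)) *\<^sub>R A + (p / (p + q)) *\<^sub>R B"
    unfolding z_def frac pt eq by (simp add: scaleR_add_right)
  have "A \<noteq> B" "C \<noteq> D"
    using pos(1,3) unfolding t_def p_def orient_coords by auto
  moreover have "0 < t / (t + w)" "t / (t + w) < 1" "0 < p / (p + q)" "p / (p + q) < 1"
    using pos by simp_all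
  ultimately have "z \<in> open_segment A B" "z \<in> open_segment C D"
    using z1 z2 unfolding in_segment by blast+
  then show ?thesis
    by (auto simp: defs)
qed

lemma crossing_iff_interiors_meet:
  assumes v: "convex_polygon n v" and ab: "(a, b) \<in> diagonals n" and cd: "(c, d) \<in> diagonals n"
    and ne: "(a, b) \<noteq> (c, d)"
  shows "crossing (a, b) (c, d) \<longleftrightarrow> open_segment (v a) (v b) \<inter> open_segment (v c) (v d) \<noteq> {}"
proof
  assume "crossing (a, b) (c, d)"
  then consider "a < c" "c < b" "b < d" | "c < a" "a < d" "d < b"
    by (auto simp: crossing_def)
  then show "open_segment (v a) (v b) \<inter> open_segment (v c) (v d) \<noteq> {}"
    using interiors_meet_if_interleaved[OF v, of a c b d]
      interiors_meet_if_interleaved[OF v, of c a d b] ab cd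
    by cases (auto simp: diagonals_def)
next
  assume "open_segment (v a) (v b) \<inter> open_segment (v c) (v d) \<noteq> {}"
  then obtain z where "z \<in> open_segment (v a) (v b)" "z \<in> open_segment (v c) (v d)"
    by blast
  then obtain t u where t: "z = (1 - t) *\<^sub>R v a + t *\<^sub>R v b"
    and u: "0 < u" "u < 1" "z = (1 - u) *\<^sub>R v c + u *\<^sub>R v d"
    unfolding in_segment by blast
  define L where "L = (\<lambda>x. orient (v a) (v b) (v x))"
  have bnds: "1 \<le> a" "a < b" "b \<le> n" "1 \<le> c" "c < d" "d \<le> n"
    using ab cd by (auto simp: diagonals_def)
  have sgn: "(x < a \<or> b < x \<longrightarrow> L x < 0) \<and> (a < x \<and> x < b \<longrightarrow> L x > 0) \<and> (x = a \<or> x = b \<longrightarrow> L x = 0)"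
    if "1 \<le> x" "x \<le> n" for x
    using orient_sign[OF v bnds(1-3) that] by (auto simp: L_def)
  have "orient (v a) (v b) z = 0"
    unfolding t orient_affine by (simp add: orient_coords)
  then have *: "(1 - u) * L c + u * L d = 0"
    unfolding u(3) orient_affine L_def .
  have "\<not> (L c > 0 \<and> L d \<ge> 0)" "\<not> (L c \<ge> 0 \<and> L d > 0)"
    "\<not> (L c < 0 \<and> L d \<le> 0)" "\<not> (L c \<le> 0 \<and> L d < 0)"
    using * u(1,2)
    by (smt (verit) mult_pos_pos mult_nonneg_nonneg mult_pos_neg mult_nonneg_nonpos)+
  then consider "L c < 0" "L d > 0" | "L c > 0" "L d < 0" | "L c = 0" "L d = 0"
    by linarith
  then show "crossing (a, b) (c, d)"
  proof cases
    case 1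
    then have "\<not> (c = a \<or> c = b)" "\<not> (a < c \<and> c < b)" "a < d \<and> d < b"
      using sgn[of c] sgn[of d] bnds by (smt (verit) nat_neq_iff le_less_trans less_imp_le)+
    then show ?thesis using bnds by (auto simp: crossing_def)
  next
    case 2
    then have "a < c \<and> c < b" "\<not> (d = a \<or> d = b)" "\<not> (a < d \<and> d < b)"
      using sgn[of c] sgn[of d] bnds by (smt (verit) nat_neq_iff le_less_trans less_imp_le)+
    then show ?thesis using bnds by (auto simp: crossing_def)
  next
    case 3
    then have "c = a \<or> c = b" "d = a \<or> d = b"
      using sgn[of c] sgn[of d] bnds by (smt (verit) nat_neq_iff le_less_trans less_imp_le)+
    then show ?thesis using bnds ne by auto
  qed
qed

definition no_3_crossing :: "(nat \<times> nat) set \<Rightarrow> bool" where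
  "no_3_crossing S \<longleftrightarrow>
     \<not> (\<exists>x \<in> S. \<exists>y \<in> S. \<exists>z \<in> S. crossing x y \<and> crossing y z \<and> crossing x z)"

definition two_triangulation :: "nat \<Rightarrow> (nat \<times> nat) set \<Rightarrow> bool" where
  "two_triangulation n S \<longleftrightarrow>
     S \<subseteq> diagonals n \<and> no_3_crossing S \<and>
     (\<forall>S'. S \<subseteq> S' \<and> S' \<subseteq> diagonals n \<and> no_3_crossing S' \<longrightarrow> S' = S)"

text \<open>Each 2-triangulation is identified with its set of nontrivial diagonals.\<close>

definition two_triangulations :: "nat \<Rightarrow> (nat \<times> nat) set set" where
  "two_triangulations n = {S \<inter> nontrivial n | S. two_triangulation n S}"

definition deg :: "(nat \<times> nat) set \<Rightarrow> nat \<Rightarrow> nat" where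
  "deg T v = card {(a, b) \<in> T. a = v \<or> b = v}"

text \<open>
  The diagonal joining the vertices with labels \<open>a\<close> and \<open>b\<close> taken modulo \<open>n\<close>, with representatives
  \<open>1, \<dots>, n\<close>; the label \<open>0\<close> denotes the vertex \<open>n\<close>.
\<close>

definition label_mod :: "nat \<Rightarrow> nat \<Rightarrow> nat" where
  "label_mod n x = (x + n - 1) mod n + 1"

definition diag_mod :: "nat \<Rightarrow> nat \<Rightarrow> nat \<Rightarrow> nat \<times> nat" where
  "diag_mod n a b =
     (min (label_mod n a) (label_mod n b), max (label_mod n a) (label_mod n b))"

definition last_short :: "nat \<Rightarrow> (nat \<times> nat) set \<Rightarrow> nat" where
  "last_short n T = Max {a. 1 \<le> a \<and> a \<le> n - 3 \<and> (a, a + 3) \<in> T}"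

definition deleted :: "nat \<Rightarrow> (nat \<times> nat) set \<Rightarrow> (nat \<times> nat) set" where
  "deleted n T =
     (let r = last_short n T in
        {(r, r + 3)}
        \<union> (if deg T (r + 1) = 0 then {diag_mod n (r - 1) (r + 2)} else {})
        \<union> (if deg T (r + 2) = 0 then {(1, r + 1)} else {})
        \<union> (if deg T (r + 1) > 0 \<and> deg T (r + 2) > 0
            then {(Max {a. 1 \<le> a \<and> a < r \<and> (a, r + 2) \<in> T}, r + 2)} else {}))"

definition contract_side :: "nat \<Rightarrow> nat \<times> nat \<Rightarrow> nat \<times> nat" where
  "contract_side r =
     (let c = (\<lambda>x. if x \<le> r + 1 then x else x - 1) in (\<lambda>(a, b). (c a, c b)))"

definition triangulation_parent :: "nat \<Rightarrow> (nat \<times> nat) set \<Rightarrow> (nat \<times> nat) set" where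
  "triangulation_parent n T = contract_side (last_short n T) ` (T - deleted n T)"

text \<open>A node is a pair of its level and the object of that level it stands for.\<close>

definition triangulation_tree :: "(nat \<times> (nat \<times> nat) set) rtree" where
  "triangulation_tree =
     \<lparr> tree_verts = {(l, T). T \<in> two_triangulations (l + 5)},
       tree_root = (0, THE T. T \<in> two_triangulations 5),
       tree_parent = (\<lambda>(l, T). (l - 1, triangulation_parent (l + 5) T)) \<rparr>"

datatype step = N | E

text \<open>
  After \<open>k\<close> steps a path starting at the origin is at the point with coordinates
  \<open>count_list (take k w) E\<close> and \<open>count_list (take k w) N\<close>.
\<close>

definition dyck_path :: "nat \<Rightarrow> step list \<Rightarrow> bool" where
  "dyck_path m w \<longleftrightarrow>
     count_list w N = m \<and> count_list w E = m \<and>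
     (\<forall>k. count_list (take k w) E \<le> count_list (take k w) N)"

text \<open>
  After \<open>k\<close> steps both paths are on the antidiagonal \<open>x + y = k\<close>; one path is never below
  another if on each antidiagonal its point is at least as high.
\<close>

definition never_below :: "step list \<Rightarrow> step list \<Rightarrow> bool" where
  "never_below P Q \<longleftrightarrow> (\<forall>k. count_list (take k Q) N \<le> count_list (take k P) N)"

definition dyck_pairs :: "nat \<Rightarrow> (step list \<times> step list) set" where
  "dyck_pairs m = {(P, Q). dyck_path m P \<and> dyck_path m Q \<and> never_below P Q}"

text \<open>The path $N E^{p_m} N E^{p_{m-1}} \cdots N E^{p_1} E$.\<close>

definition path_of :: "nat \<Rightarrow> (nat \<Rightarrow> nat) \<Rightarrow> step list" where
  "path_of m p = concat (map (\<lambda>i. N # replicate (p i) E) (rev [1..<m + 1])) @ [E]"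

text \<open>The sequence $p_1, \dots, p_m$ of a path of size \<open>m\<close>, extended by zero.\<close>

definition exponents :: "nat \<Rightarrow> step list \<Rightarrow> nat \<Rightarrow> nat" where
  "exponents m P = (THE p. P = path_of m p \<and> (\<forall>i. i < 1 \<or> m < i \<longrightarrow> p i = 0))"

definition dyck_parent :: "nat \<Rightarrow> step list \<times> step list \<Rightarrow> step list \<times> step list" where
  "dyck_parent m = (\<lambda>(P, Q).
     let p = exponents m P;
         q = exponents m Q;
         s = (LEAST j. 2 \<le> j \<and> p j * q j = 0);
         p' = (\<lambda>i. if i \<le> s - 2 then p i
                   else if i = s - 1 then p (s - 1) - 1
                   else if i = s then p s + p (s + 1)
                   else p (i + 1));
         q' = (\<lambda>i. if i \<le> s - 2 then q i
                   else if i = s - 1 then q (s - 1) + q s - 1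
                   else q (i + 1))
     in (path_of (m - 1) p', path_of (m - 1) q'))"

definition dyck_tree :: "(nat \<times> step list \<times> step list) rtree" where
  "dyck_tree =
     \<lparr> tree_verts = {(l, PQ). PQ \<in> dyck_pairs (l + 1)},
       tree_root = (0, [N, E], [N, E]),
       tree_parent = (\<lambda>(l, PQ). (l - 1, dyck_parent (l + 1) PQ)) \<rparr>"

end

theory Submission
  imports Defs
begin

text \<open>
  Every node of either tree carries a label, a list of positive integers, such that taking labels is a
  bijection from the children of a node with label \<open>L\<close> onto a set depending only on \<open>L\<close>. A node is
  then determined by the sequence of labels along its path to the root, both trees have the same
  sequences, and matching equal sequences is an isomorphism.

  For a 2-triangulation with last ear \<open>(r, r + 3)\<close> the label lists the numbers of diagonals that end
  in \<open>n - 1, n - 2, \<dots>, r + 1\<close>. The parent map contracts the side \<open>(r + 1, r + 2)\<close>; because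
  \<open>(r, r + 3)\<close> is present, all neighbours of \<open>r + 2\<close> precede all neighbours of \<open>r + 1\<close> up to one
  common neighbour \<open>v\<close>, so a child is recovered by choosing a vertex to split and one of its
  neighbours as \<open>v\<close>. For a pair of Dyck paths the label lists, up to shifts by one or two, the sums
  \<open>p\<^sub>i + q\<^sub>i\<^sub>-\<^sub>1\<close> for \<open>2 \<le> i \<le> s + 1\<close>.
\<close>

section \<open>Trees determined by labels\<close>

text \<open>Entry \<open>c\<close> of a label is the number of children produced at position
  \<open>c\<close>, and \<open>k\<close> numbers them. For 2-triangulations, position
  \<open>c\<close> is the vertex \<open>u = n - 1 - c\<close>. If \<open>v\<close> is its
  \<open>k\<close>-th left neighbour, then \<open>u + 1\<close> receives the first \<open>k\<close>
  neighbours and \<open>u - 1\<close>, \<open>u\<close> keeps the others and \<open>v\<close> once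
  more, \<open>u + 2\<close> gains the diagonal from \<open>u\<close>, and vertices below
  \<open>u\<close> leave the label, the last ear now being \<open>(u - 1, u + 2)\<close>. This is
  the rule \<open>child_label\<close>; the Dyck side has to reproduce it. The obstacle for polygons
  is maximality: both contracting and splitting must send maximal sets to maximal sets. Diagonals
  are not counted. Instead, the triple that blocks a missing diagonal is carried along the map
  merging \<open>u\<close> and \<open>u + 1\<close>. Going down, it survives because left neighbours
  of \<open>u + 1\<close> other than \<open>u - 1\<close> lie at or before \<open>v\<close>, and
  those of \<open>u\<close> at or after \<open>v\<close>; every lift of a diagonal is chosen to
  respect this order. The case distinction on degrees in the parent map then only removes diagonals
  whose images become trivial or coincide with another image.\<close>

definition child_label :: "nat list \<Rightarrow> nat \<Rightarrow> nat \<Rightarrow> nat list" where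
  "child_label L c k =
     map (\<lambda>j. if j = c then k + 1 else if j = c + 1 then L ! c + 1 - k
              else if j + 1 = c then L ! j + 1 else L ! j) [0..<c + 2]"

definition child_labels :: "nat list \<Rightarrow> nat list set" where
  "child_labels L = {child_label L c k | c k. c < length L \<and> 1 \<le> k \<and> k \<le> L ! c}"

lemma length_child_label [simp]: "length (child_label L c k) = c + 2"
  by (simp add: child_label_def)

text \<open>What keeps siblings apart: the length of a child label reveals \<open>c\<close>, and its
  entry at \<open>c\<close> reveals \<open>k\<close>.\<close>

lemma child_label_inject:
  assumes "child_label L c k = child_label L c' k'"
  shows "c = c'" "k = k'"
proof -
  have "length (child_label L c k) = length (child_label L c' k')"
    using assms by (rule arg_cong)
  then show "c = c'" by simp
  have "child_label L c k ! c = k + 1" "child_label L c' k' ! c' = k' + 1"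
    by (simp_all add: child_label_def nth_append)
  then show "k = k'" using assms \<open>c = c'\<close> by (metis add_right_cancel)
qed

text \<open>A generating tree with succession rule \<open>R\<close>. Parent map and label take the
  level as an argument because both depend on the size of the polygon or of the path.\<close>

locale labelled_levels =
  fixes V :: "nat \<Rightarrow> 'a set" and root :: 'a and par :: "nat \<Rightarrow> 'a \<Rightarrow> 'a"
    and lab :: "nat \<Rightarrow> 'a \<Rightarrow> 'l" and L0 :: 'l and R :: "'l \<Rightarrow> 'l set"
  assumes level_0: "V 0 = {root}" and lab_root: "lab 0 root = L0"
    and par_in: "y \<in> V (Suc l) \<Longrightarrow> par (Suc l) y \<in> V l"
    and lab_bij: "x \<in> V l \<Longrightarrow>
      bij_betw (lab (Suc l)) {y \<in> V (Suc l). par (Suc l) y = x} (R (lab l x))"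
begin

fun code :: "nat \<Rightarrow> 'a \<Rightarrow> 'l list" where
  "code 0 x = [lab 0 x]"
| "code (Suc l) x = lab (Suc l) x # code l (par (Suc l) x)"

definition tree :: "(nat \<times> 'a) rtree" where
  "tree = \<lparr> tree_verts = {(l, x). x \<in> V l}, tree_root = (0, root),
            tree_parent = (\<lambda>(l, x). (l - 1, par l x)) \<rparr>"

lemma hd_code: "hd (code l x) = lab l x"
  by (cases l) auto

lemma rooted_tree: "rooted_tree tree"
proof -
  have "\<exists>k. (tree_parent tree ^^ k) (l, x) = tree_root tree" if "x \<in> V l" for l x
    using that
  proof (induction l arbitrary: x)
    case 0
    then have "(tree_parent tree ^^ 0) (0, x) = tree_root tree"
      using level_0 by (simp add: tree_def)
    then show ?case by blast
  next
    case (Suc l)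
    obtain k where "(tree_parent tree ^^ k) (l, par (Suc l) x) = tree_root tree"
      using Suc.IH[OF par_in[OF Suc.prems]] by blast
    moreover have "tree_parent tree (Suc l, x) = (l, par (Suc l) x)"
      by (simp add: tree_def)
    ultimately have "(tree_parent tree ^^ Suc k) (Suc l, x) = tree_root tree"
      by (simp only: funpow_Suc_right comp_apply)
    then show ?case by blast
  qed
  moreover have "tree_parent tree v \<in> tree_verts tree"
    if v: "v \<in> tree_verts tree - {tree_root tree}" for v
  proof -
    obtain l x where lx': "v = (l, x)" by (cases v)
    then have lx: "v = (l, x)" "x \<in> V l" "(l, x) \<noteq> (0, root)"
      using v by (simp_all add: tree_def)
    then obtain l' where "l = Suc l'" using level_0 by (cases l) auto
    then show ?thesis using lx par_in[of x l'] by (simp add: tree_def)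
  qed
  moreover have "tree_root tree \<in> tree_verts tree"
    using level_0 by (simp add: tree_def)
  moreover have "\<exists>k. (tree_parent tree ^^ k) v = tree_root tree" if "v \<in> tree_verts tree" for v
    using that \<open>\<And>x l. x \<in> V l \<Longrightarrow> \<exists>k. (tree_parent tree ^^ k) (l, x) = tree_root tree\<close>
    by (cases v) (simp add: tree_def)
  ultimately show ?thesis
    unfolding rooted_tree_def by blast
qed

text \<open>The tails are the codes of the parents, so induction identifies the parents; the objects
  are then siblings, and their labels separate them.\<close>

lemma code_inj: "x \<in> V l \<Longrightarrow> y \<in> V l \<Longrightarrow> code l x = code l y \<Longrightarrow> x = y"
proof (induction l arbitrary: x y)
  case 0
  then show ?case unfolding level_0 by blast
next
  case (Suc l)
  have "code l (par (Suc l) x) = code l (par (Suc l) y)"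
    using Suc.prems(3) by simp
  then have "par (Suc l) x = par (Suc l) y"
    by (rule Suc.IH[OF par_in[OF Suc.prems(1)] par_in[OF Suc.prems(2)]])
  moreover have "lab (Suc l) x = lab (Suc l) y" using Suc.prems(3) by simp
  moreover have "inj_on (lab (Suc l)) {z \<in> V (Suc l). par (Suc l) z = par (Suc l) x}"
    using lab_bij[OF par_in[OF Suc.prems(1)]] by (rule bij_betw_imp_inj_on)
  moreover have "x \<in> {z \<in> V (Suc l). par (Suc l) z = par (Suc l) x}"
    "y \<in> {z \<in> V (Suc l). par (Suc l) z = par (Suc l) x}"
    using Suc.prems(1,2) calculation(1) by simp_all
  ultimately show ?case
    by (meson inj_onD)
qed

end

text \<open>Kept outside the locale and built from \<open>L0\<close> and \<open>R\<close> alone, so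
  that two trees with the same rule share it.\<close>

fun codes :: "'l \<Rightarrow> ('l \<Rightarrow> 'l set) \<Rightarrow> nat \<Rightarrow> 'l list set" where
  "codes L0 R 0 = {[L0]}"
| "codes L0 R (Suc l) = {L # w | L w. w \<in> codes L0 R l \<and> L \<in> R (hd w)}"

context labelled_levels
begin

lemma code_image: "code l ` V l = codes L0 R l"
proof (induction l)
  case 0
  then show ?case by (simp add: level_0 lab_root)
next
  case (Suc l)
  have *: "lab (Suc l) ` {y \<in> V (Suc l). par (Suc l) y = x} = R (lab l x)" if "x \<in> V l" for x
    using lab_bij[OF that] by (simp add: bij_betw_def)
  show ?case
  proof (intro equalityI subsetI)
    fix w assume "w \<in> code (Suc l) ` V (Suc l)"
    then obtain y where y: "y \<in> V (Suc l)" "w = code (Suc l) y" by blast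
    define x where "x = par (Suc l) y"
    have x: "x \<in> V l" unfolding x_def using y(1) by (rule par_in)
    then have "code l x \<in> codes L0 R l" unfolding Suc[symmetric] by (rule imageI)
    moreover have "lab (Suc l) y \<in> R (hd (code l x))"
      unfolding hd_code *[OF x, symmetric] using y(1) x_def by (intro imageI) simp
    ultimately show "w \<in> codes L0 R (Suc l)" using y(2) by (simp add: x_def)
  next
    fix w assume "w \<in> codes L0 R (Suc l)"
    then obtain L w' where w: "w = L # w'" "w' \<in> codes L0 R l" "L \<in> R (hd w')" by auto
    obtain x where x: "x \<in> V l" "w' = code l x" using w(2) unfolding Suc[symmetric] by blast
    have "L \<in> lab (Suc l) ` {y \<in> V (Suc l). par (Suc l) y = x}"
      using w(3) unfolding *[OF x(1)] x(2) hd_code .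
    then obtain y where "y \<in> V (Suc l)" "par (Suc l) y = x" "L = lab (Suc l) y"
      by blast
    then have "y \<in> V (Suc l)" "code (Suc l) y = w" using w(1) x(2) by simp_all
    then show "w \<in> code (Suc l) ` V (Suc l)" by blast
  qed
qed

lemma code_bij: "bij_betw (code l) (V l) (codes L0 R l)"
  by (intro bij_betw_imageI inj_onI code_image) (rule code_inj)

end

text \<open>The matching \<open>g\<close> preserves codes. Passing to the parent drops the head of
  the code, so the image of the parent and the parent of the image have equal codes and agree by
  \<open>code_inj\<close>.\<close>

lemma labelled_levels_isomorphic:
  assumes "labelled_levels V r par lab L0 R" "labelled_levels V' r' par' lab' L0 R"
  shows "rtree_isomorphic (labelled_levels.tree V r par) (labelled_levels.tree V' r' par')"
proof -
  interpret A: labelled_levels V r par lab L0 R by fact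
  interpret B: labelled_levels V' r' par' lab' L0 R by fact
  define g where "g l x = the_inv_into (V' l) (B.code l) (A.code l x)" for l x
  have bij: "bij_betw (g l) (V l) (V' l)" for l
    unfolding g_def
    using bij_betw_trans[OF A.code_bij bij_betw_the_inv_into[OF B.code_bij], of l]
    by (simp add: comp_def)
  have code: "B.code l (g l x) = A.code l x" if "x \<in> V l" for l x
    unfolding g_def using that A.code_bij[of l] B.code_bij[of l]
    by (intro f_the_inv_into_f_bij_betw) (auto simp: bij_betw_def)
  have par: "g l (par (Suc l) x) = par' (Suc l) (g (Suc l) x)" if "x \<in> V (Suc l)" for l x
  proof (rule B.code_inj)
    have x': "g (Suc l) x \<in> V' (Suc l)" using bij that by (auto simp: bij_betw_def)
    then show "par' (Suc l) (g (Suc l) x) \<in> V' l" by (rule B.par_in)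
    show "g l (par (Suc l) x) \<in> V' l"
      using bij[of l] A.par_in[OF that] by (auto simp: bij_betw_def)
    have "B.code (Suc l) (g (Suc l) x) = A.code (Suc l) x" using that by (rule code)
    then show "B.code l (g l (par (Suc l) x)) = B.code l (par' (Suc l) (g (Suc l) x))"
      using code[OF A.par_in[OF that]] by simp
  qed
  define f where "f = (\<lambda>(l, x). (l :: nat, g l x))"
  have "bij_betw f (tree_verts A.tree) (tree_verts B.tree)"
    unfolding bij_betw_def
  proof
    show "inj_on f (tree_verts A.tree)"
      using bij by (auto simp: inj_on_def f_def A.tree_def bij_betw_def)
    have "(l, y) \<in> f ` tree_verts A.tree" if y: "y \<in> V' l" for l y
    proof -
      obtain x where "x \<in> V l" "y = g l x"
        using y bij[of l] unfolding bij_betw_def by blast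
      then show ?thesis by (auto simp: f_def A.tree_def intro!: image_eqI[of _ _ "(l, x)"])
    qed
    moreover have "g l x \<in> V' l" if "x \<in> V l" for l x
      using that bij[of l] unfolding bij_betw_def by blast
    ultimately show "f ` tree_verts A.tree = tree_verts B.tree"
      by (auto simp: f_def A.tree_def B.tree_def)
  qed
  moreover have "g 0 r = r'"
    using bij[of 0] A.level_0 B.level_0 by (auto simp: bij_betw_def)
  moreover have "f (tree_parent A.tree v) = tree_parent B.tree (f v)"
    if v: "v \<in> tree_verts A.tree - {tree_root A.tree}" for v
  proof -
    obtain l x where lx': "v = (l, x)" by (cases v)
    then have lx: "v = (l, x)" "x \<in> V l" "(l, x) \<noteq> (0, r)"
      using v by (simp_all add: A.tree_def)
    then obtain l' where "l = Suc l'" using A.level_0 by (cases l) auto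
    then show ?thesis using lx par by (simp add: f_def A.tree_def B.tree_def)
  qed
  moreover have "f (tree_root A.tree) = (0, g 0 r)" "tree_root B.tree = (0, r')"
    by (simp_all add: f_def A.tree_def B.tree_def)
  ultimately show ?thesis
    unfolding rtree_isomorphic_def by metis
qed

section \<open>Maximal sets of diagonals without three mutual crossings\<close>

lemma diagonals_iff:
  "(a, b) \<in> diagonals n \<longleftrightarrow> 1 \<le> a \<and> a + 2 \<le> b \<and> b \<le> n \<and> b + 2 \<le> n + a"
  by (auto simp: diagonals_def cyclic_distance_def)

lemma nontrivial_iff:
  "(a, b) \<in> nontrivial n \<longleftrightarrow> 1 \<le> a \<and> a + 3 \<le> b \<and> b \<le> n \<and> b + 3 \<le> n + a"
  by (auto simp: nontrivial_def diagonals_def cyclic_distance_def)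

lemma nontrivial_subset: "nontrivial n \<subseteq> diagonals n"
  by (auto simp: nontrivial_def)

text \<open>Normal form of three mutually crossing diagonals, sorted by left ends; this spares the
  symmetric cases of \<open>crossing\<close>.\<close>

definition triple ::
    "(nat \<times> nat) set \<Rightarrow> nat \<Rightarrow> nat \<Rightarrow> nat \<Rightarrow> nat \<Rightarrow> nat \<Rightarrow> nat \<Rightarrow> bool" where
  "triple S a b c a' b' c' \<longleftrightarrow> a < b \<and> b < c \<and> c < a' \<and> a' < b' \<and> b' < c' \<and>
     (a, a') \<in> S \<and> (b, b') \<in> S \<and> (c, c') \<in> S"

definition has_triple :: "(nat \<times> nat) set \<Rightarrow> bool" where
  "has_triple S \<longleftrightarrow> (\<exists>a b c a' b' c'. triple S a b c a' b' c')"

lemma has_tripleI: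
  "(a, a') \<in> S \<Longrightarrow> (b, b') \<in> S \<Longrightarrow> (c, c') \<in> S \<Longrightarrow>
   a < b \<Longrightarrow> b < c \<Longrightarrow> c < a' \<Longrightarrow> a' < b' \<Longrightarrow> b' < c' \<Longrightarrow> has_triple S"
  unfolding has_triple_def triple_def by blast

lemma no_3_crossing_iff: "no_3_crossing S \<longleftrightarrow> \<not> has_triple S"
proof
  assume *: "no_3_crossing S"
  show "\<not> has_triple S"
  proof
    assume "has_triple S"
    then obtain a b c a' b' c' where "triple S a b c a' b' c'"
      unfolding has_triple_def by blast
    then have "(a, a') \<in> S" "(b, b') \<in> S" "(c, c') \<in> S"
      "crossing (a, a') (b, b')" "crossing (b, b') (c, c')" "crossing (a, a') (c, c')"
      by (auto simp: triple_def crossing_def)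
    then show False using * unfolding no_3_crossing_def by blast
  qed
next
  assume *: "\<not> has_triple S"
  show "no_3_crossing S"
    unfolding no_3_crossing_def
  proof (safe, goal_cases)
    case (1 a a' b b' c c')
    then have "a < b \<and> b < c \<or> a < c \<and> c < b \<or> b < a \<and> a < c \<or> b < c \<and> c < a
      \<or> c < a \<and> a < b \<or> c < b \<and> b < a"
      by (auto simp: crossing_def)
    then show False
      using 1(4-6) has_tripleI[OF 1(1,2,3)] has_tripleI[OF 1(1,3,2)] has_tripleI[OF 1(2,1,3)]
        has_tripleI[OF 1(2,3,1)] has_tripleI[OF 1(3,1,2)] has_tripleI[OF 1(3,2,1)] *
      by (elim disjE) (simp_all add: crossing_def)
  qed
qed

lemma has_triple_mono: "has_triple S \<Longrightarrow> S \<subseteq> S' \<Longrightarrow> has_triple S'"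
  unfolding has_triple_def triple_def by (meson subsetD)

text \<open>Since \<open>has_triple\<close> is monotone, maximality can be tested by adding one
  diagonal at a time. The triple blocking a missing diagonal is the main tool below.\<close>

lemma two_triangulation_iff:
  "two_triangulation n F \<longleftrightarrow> F \<subseteq> diagonals n \<and> \<not> has_triple F \<and>
     (\<forall>d \<in> diagonals n - F. has_triple (insert d F))"
  unfolding two_triangulation_def no_3_crossing_iff
proof (intro conj_cong refl iffI ballI allI impI)
  fix d
  assume "F \<subseteq> diagonals n" "\<forall>S'. F \<subseteq> S' \<and> S' \<subseteq> diagonals n \<and> \<not> has_triple S' \<longrightarrow> S' = F"
    "d \<in> diagonals n - F"
  then show "has_triple (insert d F)"
    by (metis Diff_iff insertI1 insert_subset subset_insertI)
next
  fix S
  assume *: "\<forall>d \<in> diagonals n - F. has_triple (insert d F)"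
    "F \<subseteq> S \<and> S \<subseteq> diagonals n \<and> \<not> has_triple S"
  show "S = F"
  proof (rule ccontr)
    assume "S \<noteq> F"
    then obtain d where "d \<in> S" "d \<notin> F" using * by blast
    then show False using * has_triple_mono[of "insert d F" S] by blast
  qed
qed

lemma two_triangulationD:
  assumes "two_triangulation n F"
  shows "F \<subseteq> diagonals n" "\<not> has_triple F"
    "d \<in> diagonals n \<Longrightarrow> d \<notin> F \<Longrightarrow> has_triple (insert d F)"
  using assms by (auto simp: two_triangulation_iff)

lemma insert_triple_cases:
  assumes "has_triple (insert (x, y) F)" "\<not> has_triple F"
  obtains
    (first) b b' c c' where "x < b" "b < c" "c < y" "y < b'" "b' < c'" "(b, b') \<in> F" "(c, c') \<in> F"
  | (middle) a a' c c' where "a < x" "x < c" "c < a'" "a' < y" "y < c'" "(a, a') \<in> F" "(c, c') \<in> F"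
  | (last) a a' b b' where "a < b" "b < x" "x < a'" "a' < b'" "b' < y" "(a, a') \<in> F" "(b, b') \<in> F"
proof -
  obtain a b c a' b' c' where t: "triple (insert (x, y) F) a b c a' b' c'"
    using assms(1) unfolding has_triple_def by blast
  have "\<not> triple F a b c a' b' c'" using assms(2) unfolding has_triple_def by blast
  then consider "a = x" "a' = y" | "b = x" "b' = y" | "c = x" "c' = y"
    using t unfolding triple_def by blast
  then show thesis
  proof cases
    case 1
    then show ?thesis using t by (intro first[of b c b' c']) (auto simp: triple_def)
  next
    case 2
    then show ?thesis using t by (intro middle[of a c a' c']) (auto simp: triple_def)
  next
    case 3
    then show ?thesis using t by (intro last[of a b a' b']) (auto simp: triple_def)
  qed
qed

text \<open>Each member is crossed by the other two, hence has at least two vertices strictly on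
  either side.\<close>

lemma triple_nontrivial:
  assumes "triple S a b c a' b' c'" "1 \<le> a" "c' \<le> n"
  shows "{(a, a'), (b, b'), (c, c')} \<subseteq> nontrivial n"
  using assms by (auto simp: triple_def nontrivial_iff)

lemma trivial_in:
  assumes F: "two_triangulation n F" and d: "d \<in> diagonals n" "d \<notin> nontrivial n"
  shows "d \<in> F"
proof (rule ccontr)
  assume "d \<notin> F"
  then obtain a b c a' b' c' where t: "triple (insert d F) a b c a' b' c'"
    using two_triangulationD(3)[OF F d(1)] unfolding has_triple_def by blast
  have sub: "insert d F \<subseteq> diagonals n"
    using two_triangulationD(1)[OF F] d(1) by blast
  have "(a, a') \<in> diagonals n" "(c, c') \<in> diagonals n"
    using t sub by (auto simp: triple_def)
  then have "{(a, a'), (b, b'), (c, c')} \<subseteq> nontrivial n"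
    using triple_nontrivial[OF t] by (simp add: diagonals_iff)
  then have "triple F a b c a' b' c'"
    using t d(2) by (auto simp: triple_def)
  then show False
    using two_triangulationD(2)[OF F] by (auto simp: has_triple_def)
qed

text \<open>For a shortest counterexample \<open>(a, b)\<close> the diagonal \<open>(a, b - 1)\<close> is absent; the triple that blocks it
  either is blocked by \<open>(a, b)\<close> already or contains a shorter diagonal ending in \<open>b\<close>.\<close>

lemma ear:
  assumes F: "two_triangulation n F" and "(a, b) \<in> F" "a + 3 \<le> b"
  shows "\<exists>c. a \<le> c \<and> c + 3 \<le> b \<and> (c, c + 3) \<in> F"
  using assms(2,3)
proof (induction "b - a" arbitrary: a b rule: less_induct)
  case less
  note free = two_triangulationD(2)[OF F]
  have IH: ?case if xy: "(x, y) \<in> F" "x + 3 \<le> y" "a \<le> x" "y \<le> b" "y - x < b - a" for x y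
  proof -
    obtain c where "x \<le> c" "c + 3 \<le> y" "(c, c + 3) \<in> F"
      using less.hyps[OF xy(5,1,2)] by blast
    then show ?thesis using xy by (intro exI[of _ c]) auto
  qed
  show ?case
  proof (cases "b = a + 3 \<or> (a, b - 1) \<in> F")
    case True
    then show ?thesis
    proof
      assume "b = a + 3"
      then show ?thesis using less.prems by blast
    next
      assume "(a, b - 1) \<in> F"
      then show ?thesis
        using IH[of a "b - 1"] less.prems by (cases "b = a + 3") auto
    qed
  next
    case False
    then have b: "a + 4 \<le> b" using less.prems by simp
    have "(a, b) \<in> diagonals n"
      using less.prems two_triangulationD(1)[OF F] by blast
    then have "(a, b - 1) \<in> diagonals n" using b by (auto simp: diagonals_iff)
    then have "has_triple (insert (a, b - 1) F)"
      using False two_triangulationD(3)[OF F] by blast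
    from this free show ?thesis
    proof (cases rule: insert_triple_cases)
      case (first x x' y y')
      show ?thesis
      proof (cases "x' = b")
        case True
        then show ?thesis using first IH[of x b] by simp
      next
        case False
        then have "has_triple F"
          using first less.prems(1) by (intro has_tripleI[of a b F x x' y y']) auto
        then show ?thesis using free by blast
      qed
    next
      case (middle x x' y y')
      show ?thesis
      proof (cases "y' = b")
        case True
        then show ?thesis using middle IH[of y b] by simp
      next
        case False
        then have "has_triple F"
          using middle less.prems(1) by (intro has_tripleI[of x x' F a b y y']) auto
        then show ?thesis using free by blast
      qed
    next
      case (last x x' y y')
      then have "has_triple F"
        using less.prems(1) by (intro has_tripleI[of x x' F y y' a b]) auto
      then show ?thesis using free by blast
    qed
  qed
qed

definition last_ear :: "(nat \<times> nat) set \<Rightarrow> nat" where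
  "last_ear F = Max {a. (a, a + 3) \<in> F}"

text \<open>The trivial diagonal \<open>(2, n)\<close> is present, and the ear below it gives the
  bound 2. A longer diagonal starting beyond the last ear would span a later ear.\<close>

lemma last_ear:
  assumes F: "two_triangulation n F" and n: "5 \<le> n"
  shows "(last_ear F, last_ear F + 3) \<in> F" "2 \<le> last_ear F" "last_ear F + 3 \<le> n"
    "(a, a + 3) \<in> F \<Longrightarrow> a \<le> last_ear F"
    "(a, b) \<in> F \<Longrightarrow> last_ear F < a \<Longrightarrow> b = a + 2"
proof -
  let ?A = "{a. (a, a + 3) \<in> F}"
  have sub: "a + 3 \<le> n" if "a \<in> ?A" for a
    using that two_triangulationD(1)[OF F] by (auto simp: diagonals_iff)
  then have fin: "finite ?A" by (intro finite_subset[of ?A "{..n}"]) force+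
  have "(2, n) \<in> F"
    using n by (intro trivial_in[OF F]) (auto simp: diagonals_iff nontrivial_iff)
  then obtain c where c: "2 \<le> c" "c \<in> ?A"
    using ear[OF F, of 2 n] n by auto
  then have "last_ear F \<in> ?A"
    unfolding last_ear_def using fin by (intro Max_in) auto
  then show "(last_ear F, last_ear F + 3) \<in> F" "last_ear F + 3 \<le> n" using sub by auto
  show le: "a \<le> last_ear F" if "(a, a + 3) \<in> F" for a
    unfolding last_ear_def using that fin by (intro Max_ge) auto
  then show "2 \<le> last_ear F" using c by force
  show "b = a + 2" if "(a, b) \<in> F" "last_ear F < a"
  proof -
    have "\<not> a + 3 \<le> b"
      using ear[OF F that(1)] that(2) le by fastforce
    moreover have "a + 2 \<le> b"
      using that(1) two_triangulationD(1)[OF F] by (auto simp: diagonals_iff)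
    ultimately show ?thesis by simp
  qed
qed

section \<open>Contracting a side and splitting a vertex\<close>

definition squeeze :: "nat \<Rightarrow> nat \<Rightarrow> nat" where
  "squeeze u x = (if x \<le> u then x else x - 1)"

text \<open>The image of the whole set, without a list of deleted diagonals: \<open>(v, u)\<close>
  and \<open>(v, u + 1)\<close> merge by themselves, and the intersection discards
  \<open>(u - 1, u + 1)\<close> and \<open>(u, u + 2)\<close>, which shrink to sides.\<close>

definition contraction :: "nat \<Rightarrow> nat \<Rightarrow> (nat \<times> nat) set \<Rightarrow> (nat \<times> nat) set" where
  "contraction n u F = {(squeeze u a, squeeze u b) | a b. (a, b) \<in> F} \<inter> diagonals n"

text \<open>The vertex \<open>u\<close> becomes the two vertices \<open>u\<close>, \<open>u + 1\<close>, and \<open>v\<close> stays joined to both. The last case includes the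
  new ear \<open>(u - 1, u + 2)\<close>, which lies over the trivial diagonal \<open>(u - 1, u + 1)\<close>.\<close>

definition splitting ::
    "nat \<Rightarrow> nat \<Rightarrow> nat \<Rightarrow> (nat \<times> nat) set \<Rightarrow> (nat \<times> nat) set" where
  "splitting n u v F = {(x, y) \<in> diagonals (n + 1).
     if x = u then y = u + 2
     else if y = u then (x, u) \<in> F \<and> v \<le> x
     else if y = u + 1 then x = u - 1 \<or> (x, u) \<in> F \<and> x \<le> v
     else (squeeze u x, squeeze u y) \<in> F}"

lemma squeeze_less_D: "squeeze u x < squeeze u y \<Longrightarrow> x < y"
  by (auto simp: squeeze_def split: if_splits)

lemma squeeze_less: "x < y \<Longrightarrow> \<not> (x = u \<and> y = u + 1) \<Longrightarrow> squeeze u x < squeeze u y"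
  by (auto simp: squeeze_def)

text \<open>Contracting \<open>u\<close> and \<open>u + 1\<close> can only destroy a triple that uses both of them, and the two
  hypotheses exclude such triples.\<close>

lemma triple_squeeze:
  assumes t: "triple G a b c a' b' c'"
    and below: "\<And>x y. (x, u) \<in> G \<Longrightarrow> (y, u + 1) \<in> G \<Longrightarrow> y + 1 < u \<Longrightarrow> y \<le> x"
    and above: "\<And>y. (u, y) \<in> G \<Longrightarrow> y = u + 2"
  shows "triple {(squeeze u x, squeeze u y) | x y. (x, y) \<in> G}
    (squeeze u a) (squeeze u b) (squeeze u c) (squeeze u a') (squeeze u b') (squeeze u c')"
proof -
  have o: "a < b" "b < c" "c < a'" "a' < b'" "b' < c'"
    and G: "(a, a') \<in> G" "(b, b') \<in> G" "(c, c') \<in> G"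
    using t by (auto simp: triple_def)
  have "\<not> (a = u \<and> b = u + 1)" "\<not> (b = u \<and> c = u + 1)" "\<not> (c = u \<and> a' = u + 1)"
    using above[of a'] above[of b'] above[of c'] G o by auto
  moreover have "\<not> (a' = u \<and> b' = u + 1)" "\<not> (b' = u \<and> c' = u + 1)"
    using below[of a b] below[of b c] G o by auto
  ultimately show ?thesis
    using o G squeeze_less unfolding triple_def by blast
qed

section \<open>Contracting a side next to the last ear\<close>

text \<open>Here \<open>n\<close> is the size after contraction, \<open>(u, u + 1)\<close> the side
  to be contracted and \<open>v\<close> the common neighbour of its ends. The neighbour
  \<open>u - 1\<close> of \<open>u + 1\<close>, always present through a trivial diagonal, is exempt
  from the order around \<open>v\<close>.\<close>

locale apex =
  fixes n u v :: nat and F :: "(nat \<times> nat) set"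
  assumes F: "two_triangulation (n + 1) F" and n: "5 \<le> n" and u: "u = last_ear F + 1"
    and apex_left: "(v, u) \<in> F" and apex_right: "(v, u + 1) \<in> F" and v: "v + 1 < u"
    and right_le: "(a, u + 1) \<in> F \<Longrightarrow> a + 1 < u \<Longrightarrow> a \<le> v"
    and left_ge: "(a, u) \<in> F \<Longrightarrow> v \<le> a"

text \<open>The apex is the largest neighbour of \<open>r + 2\<close> to the left of
  \<open>r\<close>, where \<open>r\<close> is the last ear.\<close>

lemma apex_exists:
  assumes F: "two_triangulation (n + 1) F" and n: "5 \<le> n" and u: "u = last_ear F + 1"
  shows "\<exists>v. apex n u v F"
proof -
  define r where "r = last_ear F"
  have n': "5 \<le> n + 1" using n by simp
  note r = last_ear[OF F n', folded r_def]
  note free = two_triangulationD(2)[OF F] and sub = two_triangulationD(1)[OF F]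
  define A where "A = {a. a < r \<and> (a, r + 2) \<in> F}"
  have "A \<noteq> {}"
  proof (cases "r + 3 = n + 1")
    case True
    then have "(1, r + 2) \<in> F"
      using n by (intro trivial_in[OF F]) (auto simp: diagonals_iff nontrivial_iff)
    moreover have "1 < r" using r(2) by simp
    ultimately show ?thesis by (auto simp: A_def)
  next
    case False
    \<comment> \<open>This would be an ear beyond the last one, so it is blocked. Long diagonals
      cannot start right of \<open>r\<close>, hence the blockers end in \<open>r + 2\<close> and
      \<open>r + 3\<close>, and the former supplies an element of \<open>A\<close>.\<close>
    then have "(r + 1, r + 4) \<in> diagonals (n + 1)" using r(2,3) n by (auto simp: diagonals_iff)
    moreover have "(r + 1, r + 4) \<notin> F" using r(5)[of "r + 1" "r + 4"] by auto
    ultimately have "has_triple (insert (r + 1, r + 4) F)"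
      using two_triangulationD(3)[OF F] by blast
    from this free show ?thesis
    proof (cases rule: insert_triple_cases)
      case (first b b' c c')
      then show ?thesis using r(5)[of b b'] by auto
    next
      case (middle a a' c c')
      then show ?thesis using r(5)[of c c'] by auto
    next
      case (last a a' b b')
      then have "a' = r + 2" "a < r" by linarith+
      then have "a \<in> A" using last(6) by (simp add: A_def)
      then show ?thesis by blast
    qed
  qed
  moreover have "finite A" by (auto simp: A_def)
  moreover define v where "v = Max A"
  ultimately have "v \<in> A" by (simp add: Max_in)
  then have v: "v < r" "(v, r + 2) \<in> F" by (auto simp: A_def)
  have le: "a \<le> v" if "(a, r + 2) \<in> F" "a < r" for a
    using that \<open>finite A\<close> by (auto simp: A_def v_def intro!: Max_ge)
  \<comment> \<open>A triple blocking \<open>(v, r + 1)\<close> would also be one with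
    \<open>(v, r + 2)\<close> in its place: by maximality of \<open>v\<close> none of its other
    diagonals ends in \<open>r + 2\<close>.\<close>
  have left: "(v, r + 1) \<in> F"
  proof (rule ccontr)
    assume "(v, r + 1) \<notin> F"
    moreover have "(v, r + 1) \<in> diagonals (n + 1)"
      using v sub r(3) by (auto simp: diagonals_iff)
    ultimately have "has_triple (insert (v, r + 1) F)"
      using two_triangulationD(3)[OF F] by blast
    from this free show False
    proof (cases rule: insert_triple_cases)
      case (first b b' c c')
      then have "b' \<noteq> r + 2" using le[of b] by auto
      then have "has_triple F"
        using first v by (intro has_tripleI[of v "r + 2" F b b' c c']) auto
      then show ?thesis using free by blast
    next
      case (middle a a' c c')
      then have "c' \<noteq> r + 2" using le[of c] by auto
      then have "has_triple F"
        using middle v by (intro has_tripleI[of a a' F v "r + 2" c c']) auto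
      then show ?thesis using free by blast
    next
      case (last a a' b b')
      then have "has_triple F"
        using v by (intro has_tripleI[of a a' F b b' v "r + 2"]) auto
      then show ?thesis using free by blast
    qed
  qed
  \<comment> \<open>Otherwise \<open>(a, r + 1)\<close>, \<open>(v, r + 2)\<close> and the ear
    \<open>(r, r + 3)\<close> cross mutually; this is what the ear contributes.\<close>
  have ge: "v \<le> a" if "(a, r + 1) \<in> F" for a
  proof (rule ccontr)
    assume "\<not> v \<le> a"
    then have "has_triple F"
      using that v r(1) by (intro has_tripleI[of a "r + 1" F v "r + 2" r "r + 3"]) auto
    then show False using free by blast
  qed
  have "apex n u v F"
    by unfold_locales (use F n u v left le ge in \<open>auto simp: r_def\<close>)
  then show ?thesis by blast
qed

context apex
begin

lemmas free = two_triangulationD(2)[OF F] and sub = two_triangulationD(1)[OF F]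

lemma last: "(u - 1, u + 2) \<in> F" "3 \<le> u" "u < n" "(u, y) \<in> F \<Longrightarrow> y = u + 2"
  "(x, y) \<in> F \<Longrightarrow> u \<le> x \<Longrightarrow> y = x + 2"
  using last_ear[OF F] n u by (auto simp: numeral_eq_Suc)

lemma diagonal: "(x, y) \<in> F \<Longrightarrow> 1 \<le> x \<and> x + 2 \<le> y \<and> y \<le> n + 1 \<and> y + 1 \<le> n + x"
  using sub by (auto simp: diagonals_iff)

text \<open>Triples lift because \<open>squeeze\<close> reflects strict order. For maximality a
  missing diagonal is lifted, blocked in the larger polygon, and the blocking triple squeezed down
  again.\<close>

lemma two_triangulation_contraction: "two_triangulation n (contraction n u F)"
  unfolding two_triangulation_iff
proof (intro conjI ballI)
  show "contraction n u F \<subseteq> diagonals n" by (simp add: contraction_def)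
  show "\<not> has_triple (contraction n u F)"
  proof
    assume "has_triple (contraction n u F)"
    then obtain a b c a' b' c' where t: "triple (contraction n u F) a b c a' b' c'"
      unfolding has_triple_def by blast
    have lift: "\<exists>X Y. squeeze u X = x \<and> squeeze u Y = y \<and> (X, Y) \<in> F"
      if "(x, y) \<in> contraction n u F" for x y
      using that by (auto simp: contraction_def)
    obtain A A' B B' C C' where
      "squeeze u A = a" "squeeze u A' = a'" "(A, A') \<in> F"
      "squeeze u B = b" "squeeze u B' = b'" "(B, B') \<in> F"
      "squeeze u C = c" "squeeze u C' = c'" "(C, C') \<in> F"
      using t lift[of a a'] lift[of b b'] lift[of c c'] unfolding triple_def by blast
    then have "has_triple F"
      using t squeeze_less_D[of u] unfolding triple_def
      by (intro has_tripleI[of A A' F B B' C C']) blast+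
    then show False using free by blast
  qed
next
  fix d assume d: "d \<in> diagonals n - contraction n u F"
  obtain a b where ab: "d = (a, b)" by (cases d)
  \<comment> \<open>Of the possible lifts this one keeps the order around \<open>v\<close>: a
    diagonal ending in \<open>u\<close> is sent to \<open>u\<close> if it starts after
    \<open>v\<close> and to \<open>u + 1\<close> otherwise, and \<open>A\<close> is never
    \<open>u\<close>. So \<open>triple_squeeze\<close> still applies after the insertion.\<close>
  define A B where "A = (if a < u then a else a + 1)"
    and "B = (if b < u \<or> b = u \<and> v < a then b else b + 1)"
  have diag: "1 \<le> a" "a + 2 \<le> b" "b \<le> n" "b + 2 \<le> n + a"
    using d ab by (auto simp: diagonals_iff)
  have sq: "squeeze u A = a" "squeeze u B = b"
    by (auto simp: A_def B_def squeeze_def)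
  have "(A, B) \<in> diagonals (n + 1)"
    using diag by (auto simp: A_def B_def diagonals_iff)
  moreover have "(A, B) \<notin> F"
    using d sq ab by (auto simp: contraction_def)
  ultimately have "has_triple (insert (A, B) F)"
    using two_triangulationD(3)[OF F] by blast
  then obtain x y z x' y' z' where t: "triple (insert (A, B) F) x y z x' y' z'"
    unfolding has_triple_def by blast
  let ?G = "insert (A, B) F"
  have below: "j \<le> i" if i: "(i, u) \<in> ?G" and j: "(j, u + 1) \<in> ?G" "j + 1 < u" for i j
  proof -
    have "i = A \<and> B = u \<and> v < A \<or> v \<le> i \<and> (i, u) \<in> F"
      using i left_ge[of i] diag by (auto simp: A_def B_def split: if_splits)
    moreover have "j = A \<and> B = u + 1 \<and> A \<le> v \<or> j \<le> v"
      using j right_le[of j] diag by (auto simp: A_def B_def split: if_splits)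
    ultimately show ?thesis by auto
  qed
  have above: "i = u + 2" if "(u, i) \<in> ?G" for i
    using that last(4) by (auto simp: A_def split: if_splits)
  let ?S = "{(squeeze u x, squeeze u y) | x y. (x, y) \<in> ?G}"
  have t': "triple ?S (squeeze u x) (squeeze u y) (squeeze u z)
      (squeeze u x') (squeeze u y') (squeeze u z')"
    using t below above by (rule triple_squeeze)
  have "?G \<subseteq> diagonals (n + 1)"
    using sub \<open>(A, B) \<in> diagonals (n + 1)\<close> by blast
  then have "(x, x') \<in> diagonals (n + 1)" "(z, z') \<in> diagonals (n + 1)"
    using t unfolding triple_def by blast+
  then have "1 \<le> squeeze u x" "squeeze u z' \<le> n"
    using last(2,3) by (auto simp: squeeze_def diagonals_iff)
  \<comment> \<open>Squeezing might have produced sides of the smaller polygon; members of a triple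
    cannot be sides, so all lie in the contraction or equal \<open>d\<close>.\<close>
  from triple_nontrivial[OF t' this]
  have "triple (insert d (contraction n u F)) (squeeze u x) (squeeze u y) (squeeze u z)
      (squeeze u x') (squeeze u y') (squeeze u z')"
    using t' nontrivial_subset[of n] sq ab unfolding triple_def contraction_def by auto
  then show "has_triple (insert d (contraction n u F))"
    unfolding has_triple_def by blast
qed

end

section \<open>Splitting a vertex\<close>

text \<open>Only vertices beyond the last ear may be split, so that the new ear
  \<open>(u - 1, u + 2)\<close> becomes the last one; \<open>u < n\<close> leaves room for its right
  end \<open>u + 2 \<le> n + 1\<close>.\<close>

locale split_site =
  fixes n u v :: nat and F :: "(nat \<times> nat) set"
  assumes F: "two_triangulation n F" and n: "5 \<le> n" and u: "last_ear F < u" "u < n"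
    and v: "(v, u) \<in> F"
begin

abbreviation "F' \<equiv> splitting n u v F"

lemmas free = two_triangulationD(2)[OF F] and sub = two_triangulationD(1)[OF F]

lemma diagonal: "(x, y) \<in> F \<Longrightarrow> 1 \<le> x \<and> x + 2 \<le> y \<and> y \<le> n \<and> y + 2 \<le> n + x"
  using sub by (auto simp: diagonals_iff)

lemma u_ge: "3 \<le> u"
  using last_ear(2)[OF F n] u by simp

lemma v_less: "1 \<le> v" "v + 2 \<le> u"
  using diagonal[OF v] by simp_all

lemma straddle: "(u - 1, u + 1) \<in> F"
  using u_ge u n by (intro trivial_in[OF F]) (auto simp: diagonals_iff nontrivial_iff)

lemma splitting_diagonal:
  "(x, y) \<in> F' \<Longrightarrow> 1 \<le> x \<and> x + 2 \<le> y \<and> y \<le> n + 1 \<and> y + 1 \<le> n + x"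
  by (auto simp: splitting_def diagonals_iff)

lemma splitting_at:
  "(u, y) \<in> F' \<longleftrightarrow> y = u + 2"
  "(x, u) \<in> F' \<longleftrightarrow> (x, u) \<in> F \<and> v \<le> x"
  "(x, u + 1) \<in> F' \<longleftrightarrow> x = u - 1 \<or> (x, u) \<in> F \<and> x \<le> v"
  "x \<noteq> u \<Longrightarrow> y \<noteq> u \<Longrightarrow> y \<noteq> u + 1 \<Longrightarrow>
    (x, y) \<in> F' \<longleftrightarrow> (x, y) \<in> diagonals (n + 1) \<and> (squeeze u x, squeeze u y) \<in> F"
  using u_ge u diagonal[of x u] by (auto simp: splitting_def diagonals_iff)

lemma ear_splitting: "(u - 1, u + 2) \<in> F'"
  using u_ge u straddle by (subst splitting_at(4)) (auto simp: diagonals_iff squeeze_def)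

lemma squeeze_in:
  assumes "(x, y) \<in> F'" "squeeze u x + 2 \<le> squeeze u y"
  shows "(squeeze u x, squeeze u y) \<in> F"
proof -
  consider "x = u" | "x \<noteq> u" "y = u" | "x \<noteq> u" "y = u + 1" | "x \<noteq> u" "y \<noteq> u" "y \<noteq> u + 1" by blast
  then show ?thesis
    using assms splitting_at[of y] splitting_at[of x] splitting_diagonal[of x y]
    by cases (auto simp: squeeze_def split: if_splits)
qed

lemma lift_in:
  assumes "(a, b) \<in> F"
  obtains x y where "(x, y) \<in> F'" "squeeze u x = a" "squeeze u y = b"
proof -
  define A B where "A = (if a < u then a else a + 1)"
    and "B = (if b < u \<or> b = u \<and> v < a then b else b + 1)"
  have "(A, B) \<in> F'" "squeeze u A = a" "squeeze u B = b"
    using assms diagonal[OF assms] by (auto simp: A_def B_def squeeze_def splitting_def diagonals_iff)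
  then show thesis by (rule that)
qed

text \<open>The order around \<open>v\<close> is built into \<open>splitting\<close>, so a triple
  squeezes to a triple; its members have length at least 2 and hence lie in
  \<open>F\<close>.\<close>

lemma not_has_triple_splitting: "\<not> has_triple F'"
proof
  assume "has_triple F'"
  then obtain a b c a' b' c' where t: "triple F' a b c a' b' c'"
    unfolding has_triple_def by blast
  let ?S = "{(squeeze u x, squeeze u y) | x y. (x, y) \<in> F'}"
  have t': "triple ?S (squeeze u a) (squeeze u b) (squeeze u c)
      (squeeze u a') (squeeze u b') (squeeze u c')"
  proof (rule triple_squeeze[OF t])
    show "y \<le> x" if "(x, u) \<in> F'" "(y, u + 1) \<in> F'" "y + 1 < u" for x y
      using that splitting_at(2)[of x] splitting_at(3)[of y] by auto
    show "y = u + 2" if "(u, y) \<in> F'" for y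
      using that by (simp add: splitting_at(1))
  qed
  have "(squeeze u a, squeeze u a') \<in> F" "(squeeze u b, squeeze u b') \<in> F"
    "(squeeze u c, squeeze u c') \<in> F"
    using t t' squeeze_in[of a a'] squeeze_in[of b b'] squeeze_in[of c c']
    unfolding triple_def by linarith+
  then have "has_triple F"
    using t' unfolding triple_def by (blast intro: has_tripleI)
  then show False using free by blast
qed

text \<open>If the squeezed diagonal lies in \<open>F\<close>, the diagonal was left out only
  because of the order around \<open>v\<close>, and the new ear together with \<open>(v, u)\<close>
  or \<open>(v, u + 1)\<close> blocks it. Otherwise a blocking triple of \<open>F\<close> is
  lifted.\<close>

lemma has_triple_insert_splitting:
  assumes d: "(A, B) \<in> diagonals (n + 1)" "(A, B) \<notin> F'"
  shows "has_triple (insert (A, B) F')"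
proof (cases "(squeeze u A, squeeze u B) \<in> F")
  case True
  have AB: "1 \<le> A" "A + 2 \<le> B" using d by (auto simp: diagonals_iff)
  consider "A = u" | "A \<noteq> u" "B = u" | "A \<noteq> u" "B = u + 1"
    using splitting_at(4)[of A B] d True by blast
  then show ?thesis
  proof cases
    case 1
    then have "u + 2 < B" using d splitting_at(1)[of B] AB by (cases "B = u + 2") auto
    then show ?thesis
      using 1 v_less ear_splitting splitting_at(3)[of v] v
      by (intro has_tripleI[of v "u + 1" _ "u - 1" "u + 2" u B]) auto
  next
    case 2
    then have "A < v"
      using d splitting_at(2)[of A] True AB by (auto simp: squeeze_def)
    then show ?thesis
      using 2 v_less ear_splitting splitting_at(3)[of v] v
      by (intro has_tripleI[of A u _ v "u + 1" "u - 1" "u + 2"]) auto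
  next
    case 3
    then have "v < A" "A \<noteq> u - 1"
      using d splitting_at(3)[of A] True AB by (auto simp: squeeze_def)
    then show ?thesis
      using 3 AB v_less ear_splitting splitting_at(2)[of v] v
      by (intro has_tripleI[of v u _ A "u + 1" "u - 1" "u + 2"]) auto
  qed
next
  case False
  have AB: "1 \<le> A" "A + 2 \<le> B" "B \<le> n + 1" "B + 1 \<le> n + A" using d by (auto simp: diagonals_iff)
  \<comment> \<open>These two are the only diagonals that shrink to sides, and both belong to the
    splitting.\<close>
  have "\<not> (A = u \<and> B = u + 2)" "\<not> (A = u - 1 \<and> B = u + 1)"
    using d splitting_at(1)[of B] splitting_at(3)[of A] by auto
  then have "(squeeze u A, squeeze u B) \<in> diagonals n"
    using AB u u_ge by (auto simp: squeeze_def diagonals_iff)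
  then have "has_triple (insert (squeeze u A, squeeze u B) F)"
    using False two_triangulationD(3)[OF F] by blast
  then obtain x y z x' y' z' where
    t: "triple (insert (squeeze u A, squeeze u B) F) x y z x' y' z'"
    unfolding has_triple_def by blast
  have lift: "\<exists>X Y. (X, Y) \<in> insert (A, B) F' \<and> squeeze u X = a \<and> squeeze u Y = b"
    if "(a, b) \<in> insert (squeeze u A, squeeze u B) F" for a b
    using that lift_in[of a b] by blast
  obtain X X' Y Y' Z Z' where
    "(X, X') \<in> insert (A, B) F'" "squeeze u X = x" "squeeze u X' = x'"
    "(Y, Y') \<in> insert (A, B) F'" "squeeze u Y = y" "squeeze u Y' = y'"
    "(Z, Z') \<in> insert (A, B) F'" "squeeze u Z = z" "squeeze u Z' = z'"
    using t lift[of x x'] lift[of y y'] lift[of z z'] unfolding triple_def by blast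
  note XYZ = this
  have "X < Y" "Y < Z" "Z < X'" "X' < Y'" "Y' < Z'"
    using t squeeze_less_D[of u X Y] squeeze_less_D[of u Y Z] squeeze_less_D[of u Z X']
      squeeze_less_D[of u X' Y'] squeeze_less_D[of u Y' Z']
    unfolding triple_def XYZ by simp_all
  then show ?thesis
    by (rule has_tripleI[OF XYZ(1,4,7)])
qed

lemma two_triangulation_splitting: "two_triangulation (n + 1) F'"
proof -
  have "F' \<subseteq> diagonals (n + 1)" by (auto simp: splitting_def)
  then show ?thesis
    using not_has_triple_splitting has_triple_insert_splitting
    unfolding two_triangulation_iff by fast
qed

text \<open>A later ear would start after \<open>u\<close>, since \<open>u\<close> has the single
  right neighbour \<open>u + 2\<close>; shifted down by one it would be an ear of \<open>F\<close>
  at or beyond \<open>u\<close>.\<close>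

lemma last_ear_splitting: "last_ear F' + 1 = u"
proof -
  have n': "5 \<le> n + 1" using n by simp
  note l = last_ear[OF two_triangulation_splitting n']
  have "u - 1 \<le> last_ear F'"
    using ear_splitting u_ge by (intro l(4)) (simp add: numeral_eq_Suc)
  moreover have "\<not> u \<le> last_ear F'"
  proof
    define a where "a = last_ear F'"
    assume "u \<le> last_ear F'"
    then have a: "u \<le> a" "(a, a + 3) \<in> F'" using l(1) by (auto simp: a_def)
    have "a \<noteq> u"
    proof
      assume "a = u"
      then have "a + 3 = u + 2" using a(2) splitting_at(1)[of "a + 3"] by blast
      then show False using \<open>a = u\<close> by simp
    qed
    then have "(a - 1, (a - 1) + 3) \<in> F"
      using a splitting_at(4)[of a "a + 3"] by (auto simp: squeeze_def)
    then have "a - 1 \<le> last_ear F" by (rule last_ear(4)[OF F n])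
    then show False using \<open>a \<noteq> u\<close> a(1) u by simp
  qed
  ultimately show ?thesis by simp
qed

lemma contraction_splitting: "contraction n u F' = F"
proof (intro equalityI subsetI)
  fix d assume "d \<in> contraction n u F'"
  then show "d \<in> F"
    using squeeze_in by (auto simp: contraction_def diagonals_iff)
next
  fix d assume d: "d \<in> F"
  obtain a b where ab: "d = (a, b)" by (cases d)
  then obtain x y where "(x, y) \<in> F'" "squeeze u x = a" "squeeze u y = b"
    using lift_in d by blast
  then show "d \<in> contraction n u F'"
    using ab d sub by (auto simp: contraction_def)
qed

end

context apex
begin

text \<open>From \<open>u\<close> on only diagonals of length 2 start in \<open>F\<close>, and
  squeezing does not lengthen them, so no ear of the contraction starts there.\<close>

lemma split_site_contraction: "split_site n u v (contraction n u F)"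
proof
  show "two_triangulation n (contraction n u F)" by (rule two_triangulation_contraction)
  show "5 \<le> n" by (rule n)
  show "last_ear (contraction n u F) < u"
  proof (rule ccontr)
    define c where "c = last_ear (contraction n u F)"
    assume "\<not> last_ear (contraction n u F) < u"
    then have "u \<le> c" "(c, c + 3) \<in> contraction n u F"
      using last_ear(1)[OF two_triangulation_contraction n] by (auto simp: c_def)
    then obtain x y where xy: "(x, y) \<in> F" "squeeze u x = c" "squeeze u y = c + 3"
      by (auto simp: contraction_def)
    then have "u \<le> x" using \<open>u \<le> c\<close> by (auto simp: squeeze_def split: if_splits)
    then have "y = x + 2" using last(5) xy by blast
    then show False using xy \<open>u \<le> x\<close> by (auto simp: squeeze_def split: if_splits)
  qed
  show "u < n" by (rule last(3))
  show "(v, u) \<in> contraction n u F"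
  proof -
    have "v = squeeze u v" "u = squeeze u u" "(v, u) \<in> diagonals n"
      using last(3) diagonal[OF apex_left] by (auto simp: squeeze_def diagonals_iff)
    then show ?thesis using apex_left unfolding contraction_def by blast
  qed
qed

text \<open>One inclusion suffices: \<open>F\<close> is maximal and the splitting contains no
  triple.\<close>

lemma eq_splitting: "F = splitting n u v (contraction n u F)"
proof -
  interpret S: split_site n u v "contraction n u F" by (rule split_site_contraction)
  have "F \<subseteq> splitting n u v (contraction n u F)"
  proof
    fix d assume d: "d \<in> F"
    obtain x y where xy: "d = (x, y)" by (cases d)
    note D = diagonal[OF d[unfolded xy]]
    have C: "(squeeze u x, squeeze u y) \<in> contraction n u F"
      if "(squeeze u x, squeeze u y) \<in> diagonals n"
      using that d xy by (auto simp: contraction_def)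
    consider "x = u" | "x \<noteq> u" "y = u" | "x \<noteq> u" "y = u + 1" | "x \<noteq> u" "y \<noteq> u" "y \<noteq> u + 1" by blast
    then have "(x, y) \<in> S.F'"
    proof cases
      case 1
      then show ?thesis using d xy last(4) S.splitting_at(1) by blast
    next
      case 2
      then show ?thesis
        using d xy left_ge[of x] C D last(2,3) S.splitting_at(2)[of x]
        by (auto simp: squeeze_def diagonals_iff)
    next
      case 3
      then show ?thesis
        using d xy right_le[of x] C D last(2,3) S.splitting_at(3)[of x]
        by (cases "x = u - 1"; cases "x + 2 \<le> u") (auto simp: squeeze_def diagonals_iff)
    next
      case 4
      have "(squeeze u x, squeeze u y) \<in> diagonals n"
        using 4 D last(2,3) by (auto simp: squeeze_def diagonals_iff)
      then show ?thesis
        using 4 C D S.splitting_at(4)[of x y] by (auto simp: diagonals_iff)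
    qed
    then show "d \<in> S.F'" using xy by simp
  qed
  then show ?thesis
    using F S.two_triangulation_splitting
    unfolding two_triangulation_def by metis
qed

end

section \<open>Labels of 2-triangulations\<close>

text \<open>Trivial diagonals count. Vertex \<open>n\<close> gets no entry because it is never
  split.\<close>

definition tri_label :: "nat \<Rightarrow> (nat \<times> nat) set \<Rightarrow> nat list" where
  "tri_label n F = map (\<lambda>j. card {a. (a, n - 1 - j) \<in> F}) [0..<n - 1 - last_ear F]"

text \<open>Translates the choice of \<open>v\<close> among the left neighbours of \<open>u\<close>
  into the number \<open>k\<close>.\<close>

lemma rank_bij_betw:
  fixes A :: "nat set"
  assumes "finite A"
  shows "bij_betw (\<lambda>v. card {a \<in> A. a \<le> v}) A {1..card A}"
proof -
  let ?f = "\<lambda>v. card {a \<in> A. a \<le> v}"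
  have less: "?f v < ?f w" if "v \<in> A" "w \<in> A" "v < w" for v w
  proof (rule psubset_card_mono)
    have "w \<in> {a \<in> A. a \<le> w}" "w \<notin> {a \<in> A. a \<le> v}" using that by auto
    then show "{a \<in> A. a \<le> v} \<subset> {a \<in> A. a \<le> w}" using that by fastforce
  qed (use assms in simp)
  have inj: "inj_on ?f A"
  proof (rule inj_onI)
    fix v w assume "v \<in> A" "w \<in> A" "?f v = ?f w"
    then show "v = w" using less[of v w] less[of w v] by (cases v w rule: linorder_cases) auto
  qed
  have "?f v \<in> {1..card A}" if "v \<in> A" for v
  proof -
    have "{a \<in> A. a \<le> v} \<noteq> {}" using that by auto
    then show ?thesis
      using assms card_mono[of A "{a \<in> A. a \<le> v}"] by (auto simp: Suc_le_eq card_gt_0_iff)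
  qed
  then have "?f ` A \<subseteq> {1..card A}" by blast
  then have "?f ` A = {1..card A}"
    using card_image[OF inj] by (intro card_subset_eq) auto
  then show ?thesis using inj by (rule bij_betw_imageI[rotated])
qed

context split_site
begin

lemma finite_below: "finite {a. (a, y) \<in> F}"
proof (rule finite_subset)
  show "{a. (a, y) \<in> F} \<subseteq> {..y}"
  proof
    fix a assume "a \<in> {a. (a, y) \<in> F}"
    then show "a \<in> {..y}" using diagonal[of a y] by simp
  qed
qed simp

lemma tri_label_splitting:
  "tri_label (n + 1) F' =
     child_label (tri_label n F) (n - 1 - u) (card {a \<in> {a. (a, u) \<in> F}. a \<le> v})"
proof (rule nth_equalityI)
  let ?c = "n - 1 - u" and ?k = "card {a \<in> {a. (a, u) \<in> F}. a \<le> v}"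
  have last: "last_ear F' = u - 1" using last_ear_splitting by simp
  show "length (tri_label (n + 1) F') = length (child_label (tri_label n F) ?c ?k)"
    using u u_ge by (simp add: tri_label_def last)
  fix j assume "j < length (tri_label (n + 1) F')"
  then have j': "j < n - last_ear F'" by (simp add: tri_label_def)
  then have j: "j < ?c + 2" using u u_ge last by simp
  have lhs: "tri_label (n + 1) F' ! j = card {a. (a, n - j) \<in> F'}"
    using j' by (simp add: tri_label_def)
  have L: "tri_label n F ! i = card {a. (a, n - 1 - i) \<in> F}" if "i \<le> ?c" for i
  proof -
    have "i < n - 1 - last_ear F" using that u by arith
    then show ?thesis by (simp add: tri_label_def)
  qed
  have rhs: "child_label (tri_label n F) ?c ?k ! j =
      (if j = ?c then ?k + 1 else if j = ?c + 1 then tri_label n F ! ?c + 1 - ?k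
       else if j + 1 = ?c then tri_label n F ! j + 1 else tri_label n F ! j)"
    using j by (simp add: child_label_def del: upt_Suc)
  consider "j = ?c" | "j = ?c + 1" | "j + 1 = ?c" | "j + 1 < ?c" using j by linarith
  then show "tri_label (n + 1) F' ! j = child_label (tri_label n F) ?c ?k ! j"
  proof cases
    case 1
    have "{a. (a, u + 1) \<in> F'} = insert (u - 1) {a \<in> {a. (a, u) \<in> F}. a \<le> v}"
      using splitting_at(3) by blast
    moreover have "u - 1 \<notin> {a \<in> {a. (a, u) \<in> F}. a \<le> v}"
      using v_less by auto
    moreover have "n - j = u + 1" using 1 u by simp
    ultimately show ?thesis
      unfolding lhs rhs using 1 finite_below[of u] by simp
  next
    case 2
    \<comment> \<open>The extra 1 is \<open>v\<close>, the one element counted on both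
      sides.\<close>
    have split: "card A + 1 = card {a \<in> A. a \<le> v} + card {a \<in> A. v \<le> a}"
      if "finite A" "v \<in> A" for A
    proof -
      have "{a \<in> A. a \<le> v} \<union> {a \<in> A. v \<le> a} = A" "{a \<in> A. a \<le> v} \<inter> {a \<in> A. v \<le> a} = {v}"
        using that by auto
      then show ?thesis
        using card_Un_Int[of "{a \<in> A. a \<le> v}" "{a \<in> A. v \<le> a}"] that by simp
    qed
    have "{a. (a, u) \<in> F'} = {a \<in> {a. (a, u) \<in> F}. v \<le> a}"
      using splitting_at(2) by blast
    then have "card {a. (a, u) \<in> F} + 1 = ?k + card {a. (a, u) \<in> F'}"
      using split[OF finite_below[of u]] v by simp
    moreover have "n - j = u" "n - 1 - ?c = u" using 2 u by simp_all
    ultimately show ?thesis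
      unfolding lhs rhs using 2 L[of ?c] by simp
  next
    case 3
    have j': "n - j = u + 2" "n - 1 - j = u + 1" using 3 u by simp_all
    have "{a. (a, u + 2) \<in> F'} = insert u {a. (a, u + 1) \<in> F}"
    proof (intro equalityI subsetI)
      fix a assume "a \<in> {a. (a, u + 2) \<in> F'}"
      then show "a \<in> insert u {a. (a, u + 1) \<in> F}"
        using splitting_at(4)[of a "u + 2"] splitting_diagonal[of a "u + 2"]
        by (cases "a = u") (auto simp: squeeze_def)
    next
      fix a assume "a \<in> insert u {a. (a, u + 1) \<in> F}"
      then show "a \<in> {a. (a, u + 2) \<in> F'}"
        using splitting_at(1)[of "u + 2"] splitting_at(4)[of a "u + 2"] diagonal[of a "u + 1"]
        by (cases "a = u") (auto simp: squeeze_def diagonals_iff)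
    qed
    moreover have "u \<notin> {a. (a, u + 1) \<in> F}" using diagonal[of u "u + 1"] by auto
    ultimately show ?thesis
      unfolding lhs rhs using 3 L[of j] finite_below[of "u + 1"] j' by simp
  next
    case 4
    define y where "y = n - j"
    have y: "u + 3 \<le> y" "y \<le> n" "n - 1 - j = y - 1" using 4 u by (simp_all add: y_def)
    have mem: "(a, y) \<in> F' \<longleftrightarrow> (a, y) \<in> diagonals (n + 1) \<and> (squeeze u a, y - 1) \<in> F \<and> a \<noteq> u" for a
      using y splitting_at(1)[of y] splitting_at(4)[of a y]
      by (cases "a = u") (auto simp: squeeze_def)
    \<comment> \<open>No diagonal ending this far right starts at \<open>u\<close>, and without
      \<open>u\<close> the map \<open>squeeze u\<close> is injective.\<close>
    have "bij_betw (squeeze u) {a. (a, y) \<in> F'} {a. (a, y - 1) \<in> F}"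
    proof (rule bij_betw_imageI)
      show "inj_on (squeeze u) {a. (a, y) \<in> F'}"
      proof (rule inj_onI)
        fix a b assume "a \<in> {a. (a, y) \<in> F'}" "b \<in> {a. (a, y) \<in> F'}" "squeeze u a = squeeze u b"
        moreover from this have "a \<noteq> u" "b \<noteq> u" using mem by blast+
        ultimately show "a = b" by (auto simp: squeeze_def split: if_splits)
      qed
      show "squeeze u ` {a. (a, y) \<in> F'} = {a. (a, y - 1) \<in> F}"
      proof (intro equalityI subsetI)
        fix a assume "a \<in> {a. (a, y - 1) \<in> F}"
        then have a: "(a, y - 1) \<in> F" by simp
        define a' where "a' = (if a < u then a else a + 1)"
        have "squeeze u a' = a" "a' \<noteq> u" by (simp_all add: a'_def squeeze_def)
        moreover have "(a', y) \<in> diagonals (n + 1)"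
          using diagonal[OF a] y by (auto simp: a'_def diagonals_iff)
        ultimately have "(a', y) \<in> F'" using a mem by simp
        then show "a \<in> squeeze u ` {a. (a, y) \<in> F'}" using \<open>squeeze u a' = a\<close> by blast
      qed (use mem in blast)
    qed
    then have "card {a. (a, y) \<in> F'} = card {a. (a, y - 1) \<in> F}"
      by (rule bij_betw_same_card)
    then show ?thesis
      unfolding lhs rhs using 4 L[of j] y by (simp add: y_def[symmetric])
  qed
qed

end

text \<open>Children are the splittings at pairs \<open>(u, v)\<close>, matched with
  \<open>(c, k)\<close> by \<open>c = n - 1 - u\<close> and \<open>k\<close> the rank of
  \<open>v\<close>.\<close>

lemma tri_label_bij_betw:
  assumes F: "two_triangulation n F" and n: "5 \<le> n"
  shows "bij_betw (tri_label (n + 1))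
    {G. two_triangulation (n + 1) G \<and> contraction n (last_ear G + 1) G = F}
    (child_labels (tri_label n F))" (is "bij_betw _ ?C _")
proof -
  let ?A = "\<lambda>u. {a. (a, u) \<in> F}"
  let ?L = "tri_label n F"
  have site: "split_site n u v F" if "last_ear F < u" "u < n" "(v, u) \<in> F" for u v
    using that F n by unfold_locales
  have L: "length ?L = n - 1 - last_ear F" by (simp add: tri_label_def)
  have Lu: "?L ! (n - 1 - u) = card (?A u)" if "last_ear F < u" "u < n" for u
  proof -
    have "n - 1 - u < n - 1 - last_ear F" using that by arith
    then show ?thesis using that by (simp add: tri_label_def)
  qed
  have child: "splitting n u v F \<in> ?C \<and> finite (?A u) \<and>
      tri_label (n + 1) (splitting n u v F) = child_label ?L (n - 1 - u) (card {a \<in> ?A u. a \<le> v})"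
    if "last_ear F < u" "u < n" "(v, u) \<in> F" for u v
  proof -
    interpret split_site n u v F using that by (rule site)
    show ?thesis
      using two_triangulation_splitting last_ear_splitting contraction_splitting
        tri_label_splitting finite_below by simp
  qed
  have ex: "\<exists>u v. last_ear F < u \<and> u < n \<and> (v, u) \<in> F \<and> G = splitting n u v F" if "G \<in> ?C" for G
  proof -
    have G: "two_triangulation (n + 1) G" "contraction n (last_ear G + 1) G = F"
      using that by simp_all
    obtain v where "apex n (last_ear G + 1) v G"
      using apex_exists[OF G(1) n refl] by blast
    then interpret G: apex n "last_ear G + 1" v G .
    have "split_site n (last_ear G + 1) v F"
      using G.split_site_contraction unfolding G(2) .
    moreover have "G = splitting n (last_ear G + 1) v F"
      using G.eq_splitting unfolding G(2) .
    ultimately show ?thesis unfolding split_site_def by blast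
  qed
  have "tri_label (n + 1) G \<in> child_labels ?L" if G: "G \<in> ?C" for G
  proof -
    obtain u v where uv: "last_ear F < u" "u < n" "(v, u) \<in> F" "G = splitting n u v F"
      using ex[OF G] by blast
    have "card {a \<in> ?A u. a \<le> v} \<in> {1..card (?A u)}"
      using rank_bij_betw[of "?A u"] child[OF uv(1-3)] uv(3) unfolding bij_betw_def by blast
    moreover have "n - 1 - u < length ?L" using uv L by simp
    ultimately show ?thesis
      using child[OF uv(1-3)] uv(4) Lu[OF uv(1,2)] unfolding child_labels_def by fastforce
  qed
  moreover have "G = G'" if G: "G \<in> ?C" "G' \<in> ?C" "tri_label (n + 1) G = tri_label (n + 1) G'" for G G'
  proof -
    obtain u v where uv: "last_ear F < u" "u < n" "(v, u) \<in> F" "G = splitting n u v F"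
      using ex[OF G(1)] by blast
    obtain u' v' where uv': "last_ear F < u'" "u' < n" "(v', u') \<in> F" "G' = splitting n u' v' F"
      using ex[OF G(2)] by blast
    have eq: "child_label ?L (n - 1 - u) (card {a \<in> ?A u. a \<le> v}) =
        child_label ?L (n - 1 - u') (card {a \<in> ?A u'. a \<le> v'})"
      using child[OF uv(1-3)] child[OF uv'(1-3)] uv(4) uv'(4) G(3) by simp
    have "u = u'" using child_label_inject(1)[OF eq] uv(2) uv'(2) by simp
    moreover have "v = v'"
      using child_label_inject(2)[OF eq] \<open>u = u'\<close> uv(3) uv'(3) child[OF uv(1-3)]
        rank_bij_betw[of "?A u"] unfolding bij_betw_def inj_on_def by simp
    ultimately show ?thesis using uv(4) uv'(4) by simp
  qed
  moreover have "\<exists>G \<in> ?C. l = tri_label (n + 1) G" if l: "l \<in> child_labels ?L" for l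
  proof -
    obtain c k where ck: "l = child_label ?L c k" "c < length ?L" "1 \<le> k" "k \<le> ?L ! c"
      using l unfolding child_labels_def by blast
    define u where "u = n - 1 - c"
    have u: "last_ear F < u" "u < n" "c = n - 1 - u" using ck(2) L by (auto simp: u_def)
    have "?A u \<noteq> {}" using Lu[OF u(1,2)] ck(3,4) u(3) by (metis card.empty le_zero_eq not_one_le_zero)
    then have "finite (?A u)" using child[OF u(1,2)] by blast
    then have "(\<lambda>v. card {a \<in> ?A u. a \<le> v}) ` ?A u = {1..card (?A u)}"
      by (intro bij_betw_imp_surj_on rank_bij_betw)
    moreover have "k \<in> {1..card (?A u)}" using ck(3,4) Lu[OF u(1,2)] u(3) by simp
    ultimately obtain v where v: "(v, u) \<in> F" "card {a \<in> ?A u. a \<le> v} = k"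
      by (metis (no_types, lifting) imageE mem_Collect_eq)
    have "l = tri_label (n + 1) (splitting n u v F)"
      using child[OF u(1,2) v(1)] unfolding v(2) ck(1) u(3) by simp
    then show ?thesis using child[OF u(1,2) v(1)] by blast
  qed
  ultimately show ?thesis
    by (intro bij_betw_imageI inj_onI equalityI subsetI) blast+
qed

section \<open>The tree of 2-triangulations\<close>

context apex
begin

abbreviation "T \<equiv> F \<inter> nontrivial (n + 1)"

lemma last_short_eq: "last_short (n + 1) T + 1 = u"
proof -
  have "{a. 1 \<le> a \<and> a \<le> n + 1 - 3 \<and> (a, a + 3) \<in> T} = {a. (a, a + 3) \<in> F}"
    using diagonal n by (fastforce simp: nontrivial_iff)
  then show ?thesis by (simp add: last_short_def last_ear_def u)
qed

lemma deg_eq_0: "deg T x = 0 \<longleftrightarrow> (\<forall>a b. (a, b) \<in> T \<longrightarrow> a \<noteq> x \<and> b \<noteq> x)"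
proof -
  have "nontrivial (n + 1) \<subseteq> {..n + 1} \<times> {..n + 1}" by (auto simp: nontrivial_iff)
  then have "finite (nontrivial (n + 1))" by (rule finite_subset) simp
  then have "finite {(a, b) \<in> T. a = x \<or> b = x}" by (rule rev_finite_subset) auto
  then show ?thesis unfolding deg_def by auto
qed

text \<open>The left neighbours of \<open>u\<close> start with \<open>v\<close> and its only right
  neighbour is \<open>u + 2\<close>; everything at \<open>u\<close> is trivial exactly when
  \<open>(v, u)\<close> is.\<close>

lemma deg_u: "deg T u = 0 \<longleftrightarrow> v + 2 = u"
proof -
  have "v + 2 = u" if "deg T u = 0"
  proof -
    have "(v, u) \<notin> nontrivial (n + 1)" using that apex_left unfolding deg_eq_0 by blast
    then show ?thesis using v diagonal[OF apex_left] last(3) by (auto simp: nontrivial_iff)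
  qed
  moreover have False if "v + 2 = u" "(a, b) \<in> T" "a = u \<or> b = u" for a b
    using that left_ge[of a] last(4)[of b] by (auto simp: nontrivial_iff)
  ultimately show ?thesis unfolding deg_eq_0 by blast
qed

text \<open>Here \<open>(v, u + 1)\<close> can be trivial only around the other side of the polygon,
  as \<open>(1, n)\<close> in an \<open>(n + 1)\<close>-gon.\<close>

lemma deg_Suc_u: "deg T (u + 1) = 0 \<longleftrightarrow> v = 1 \<and> u + 1 = n"
proof -
  have "v = 1 \<and> u + 1 = n" if "deg T (u + 1) = 0"
  proof -
    have "(v, u + 1) \<notin> nontrivial (n + 1)" using that apex_right unfolding deg_eq_0 by blast
    then show ?thesis using v diagonal[OF apex_right] last(3) by (auto simp: nontrivial_iff)
  qed
  moreover have False if "v = 1" "u + 1 = n" "(a, b) \<in> T" "a = u + 1 \<or> b = u + 1" for a b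
    using that right_le[of a] last(5)[of "u + 1" b] by (auto simp: nontrivial_iff)
  ultimately show ?thesis unfolding deg_eq_0 by blast
qed

text \<open>The three degree cases are one rule: besides the ear, one of the two diagonals from the
  apex goes. Both degrees cannot vanish, as that would force \<open>n = 4\<close>.\<close>

lemma deleted_eq:
  "deleted (n + 1) T = {(u - 1, u + 2), if v = 1 \<and> u + 1 = n then (v, u) else (v, u + 1)}"
proof -
  have r: "last_short (n + 1) T = u - 1" using last_short_eq by simp
  have arith: "u - 1 + 1 = u" "u - 1 + 2 = u + 1" "u - 1 + 3 = u + 2" "u - 1 - 1 = u - 2"
    using last(2) by simp_all
  consider "v + 2 = u" "\<not> (v = 1 \<and> u + 1 = n)" | "v + 2 \<noteq> u" "v = 1" "u + 1 = n"
    | "v + 2 \<noteq> u" "\<not> (v = 1 \<and> u + 1 = n)"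
    using n by linarith
  then show ?thesis
  proof cases
    case 1
    \<comment> \<open>No wrap-around occurs: \<open>r - 1 = u - 2\<close> is at least 1.\<close>
    have "label_mod (n + 1) x = x" if "1 \<le> x" "x \<le> n + 1" for x
      using that by (auto simp: label_mod_def mod_if)
    then have "diag_mod (n + 1) (u - 2) (u + 1) = (v, u + 1)"
      using last(2,3) 1 by (simp add: diag_mod_def)
    moreover have "deg T u = 0" "deg T (u + 1) \<noteq> 0" using 1 deg_u deg_Suc_u by simp_all
    ultimately show ?thesis
      unfolding deleted_def Let_def r arith using 1 by auto
  next
    case 2
    then have "deg T u \<noteq> 0" "deg T (u + 1) = 0" using deg_u deg_Suc_u by simp_all
    then show ?thesis
      unfolding deleted_def Let_def r arith using 2 by auto
  next
    case 3
    then have "(v, u + 1) \<in> nontrivial (n + 1)"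
      using diagonal[OF apex_right] v last(3) by (auto simp: nontrivial_iff)
    moreover have "{a. 1 \<le> a \<and> a < u - 1 \<and> (a, u + 1) \<in> T} \<subseteq> {..v}"
      using right_le by auto
    ultimately have "Max {a. 1 \<le> a \<and> a < u - 1 \<and> (a, u + 1) \<in> T} = v"
      using apex_right v diagonal[OF apex_right]
      by (intro Max_eqI) (auto intro: finite_subset)
    moreover have "deg T u \<noteq> 0" "deg T (u + 1) \<noteq> 0" using 3 deg_u deg_Suc_u by simp_all
    ultimately show ?thesis
      unfolding deleted_def Let_def r arith using 3 by auto
  qed
qed

text \<open>The ear becomes trivial. The second deleted diagonal either becomes trivial too or is
  the duplicate \<open>(v, u + 1)\<close> of \<open>(v, u)\<close>.\<close>

lemma triangulation_parent_eq:
  "triangulation_parent (n + 1) T = contraction n u F \<inter> nontrivial n"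
proof -
  have c: "contract_side (last_short (n + 1) T) = (\<lambda>(a, b). (squeeze u a, squeeze u b))"
    unfolding contract_side_def Let_def squeeze_def last_short_eq ..
  show ?thesis
    unfolding triangulation_parent_def c
  proof (intro equalityI subsetI)
    fix d assume "d \<in> (\<lambda>(a, b). (squeeze u a, squeeze u b)) ` (T - deleted (n + 1) T)"
    then obtain x y where xy: "(x, y) \<in> F" "(x, y) \<in> nontrivial (n + 1)"
      "(x, y) \<notin> deleted (n + 1) T" "d = (squeeze u x, squeeze u y)" by auto
    have nt: "1 \<le> x" "x + 3 \<le> y" "y \<le> n + 1" "y + 2 \<le> n + x"
      using xy(2) by (auto simp: nontrivial_iff)
    have "x < u" using last(5)[OF xy(1)] nt by linarith
    have "(squeeze u x, squeeze u y) \<in> nontrivial n"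
    proof (cases "y \<le> u")
      case True
      have "y + 3 \<le> n + x"
      proof (rule ccontr)
        assume "\<not> y + 3 \<le> n + x"
        then have "x = 1" "y = u" "u + 1 = n" using nt True last(3) by linarith+
        moreover from this have "v = 1" using left_ge[of 1] xy(1) diagonal[OF apex_left] by simp
        ultimately show False using xy(3) unfolding deleted_eq by simp
      qed
      then show ?thesis using True nt last(3) \<open>x < u\<close> by (auto simp: nontrivial_iff squeeze_def)
    next
      case False
      have "y \<noteq> x + 3"
      proof
        assume y: "y = x + 3"
        then have "x = u - 2 \<or> x = u - 1" using False \<open>x < u\<close> by linarith
        then show False
        proof
          assume x: "x = u - 2"
          then have y': "y = u + 1" "x + 1 < u" using y last(2) by linarith+
          then have "x = v" using right_le[of x] xy(1) v x by auto
          moreover have "\<not> (v = 1 \<and> u + 1 = n)" using \<open>x = v\<close> x n by linarith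
          ultimately show False using xy(3) y' unfolding deleted_eq by (auto split: if_splits)
        next
          assume "x = u - 1"
          then show False using xy(3) y last(2) unfolding deleted_eq by auto
        qed
      qed
      then show ?thesis using False nt \<open>x < u\<close> by (auto simp: nontrivial_iff squeeze_def)
    qed
    then show "d \<in> contraction n u F \<inter> nontrivial n"
      using xy nontrivial_subset by (auto simp: contraction_def)
  next
    fix d assume d: "d \<in> contraction n u F \<inter> nontrivial n"
    then obtain x y where xy: "(x, y) \<in> F" "d = (squeeze u x, squeeze u y)"
      by (auto simp: contraction_def)
    have nt: "squeeze u x + 3 \<le> squeeze u y" "squeeze u y + 3 \<le> n + squeeze u x"
      using d xy by (auto simp: nontrivial_iff)
    have lift: "(X, Y) \<in> nontrivial (n + 1)"
      if "(X, Y) \<in> F" "squeeze u X = squeeze u x" "squeeze u Y = squeeze u y" for X Y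
      using nt diagonal[OF that(1)] that(2,3) unfolding nontrivial_iff squeeze_def
      by (auto split: if_splits)
    \<comment> \<open>Among deleted diagonals only \<open>(v, u + 1)\<close> can have a nontrivial
      image; then \<open>(v, u)\<close> is an undeleted one with the same image.\<close>
    have "\<exists>X Y. (X, Y) \<in> F \<and> squeeze u X = squeeze u x \<and> squeeze u Y = squeeze u y
        \<and> (X, Y) \<notin> deleted (n + 1) T"
    proof (cases "(x, y) \<in> deleted (n + 1) T")
      case True
      moreover have "(x, y) \<noteq> (u - 1, u + 2)"
        using nt(1) last(2) by (auto simp: squeeze_def split: if_splits)
      moreover have "\<not> ((x, y) = (v, u) \<and> v = 1 \<and> u + 1 = n)"
        using nt(2) last(2) by (auto simp: squeeze_def split: if_splits)
      ultimately have "(x, y) = (v, u + 1)" "\<not> (v = 1 \<and> u + 1 = n)"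
        unfolding deleted_eq by (auto split: if_splits)
      then show ?thesis
        using apex_left v unfolding deleted_eq
        by (intro exI[of _ v] exI[of _ u]) (auto simp: squeeze_def)
    qed (use xy in blast)
    then obtain X Y where XY: "(X, Y) \<in> F" "squeeze u X = squeeze u x" "squeeze u Y = squeeze u y"
      "(X, Y) \<notin> deleted (n + 1) T" by blast
    then have "(X, Y) \<in> T - deleted (n + 1) T" using lift by blast
    then have "(\<lambda>(a, b). (squeeze u a, squeeze u b)) (X, Y)
        \<in> (\<lambda>(a, b). (squeeze u a, squeeze u b)) ` (T - deleted (n + 1) T)" by (rule imageI)
    then show "d \<in> (\<lambda>(a, b). (squeeze u a, squeeze u b)) ` (T - deleted (n + 1) T)"
      using XY(2,3) xy(2) by simp
  qed
qed

end

section \<open>Passing between nontrivial diagonals and full 2-triangulations\<close>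

definition with_trivial :: "nat \<Rightarrow> (nat \<times> nat) set \<Rightarrow> (nat \<times> nat) set" where
  "with_trivial n T = T \<union> (diagonals n - nontrivial n)"

lemma with_trivial_inter:
  assumes "two_triangulation n F"
  shows "with_trivial n (F \<inter> nontrivial n) = F"
  using trivial_in[OF assms] two_triangulationD(1)[OF assms] by (auto simp: with_trivial_def)

lemma two_triangulations_iff:
  "T \<in> two_triangulations n \<longleftrightarrow> T \<subseteq> nontrivial n \<and> two_triangulation n (with_trivial n T)"
proof
  assume "T \<in> two_triangulations n"
  then obtain F where "two_triangulation n F" "T = F \<inter> nontrivial n"
    by (auto simp: two_triangulations_def)
  then show "T \<subseteq> nontrivial n \<and> two_triangulation n (with_trivial n T)"
    using with_trivial_inter by auto
next
  assume T: "T \<subseteq> nontrivial n \<and> two_triangulation n (with_trivial n T)"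
  moreover have "T = with_trivial n T \<inter> nontrivial n"
    using T by (auto simp: with_trivial_def)
  ultimately show "T \<in> two_triangulations n"
    unfolding two_triangulations_def by blast
qed

lemma bij_betw_with_trivial:
  "bij_betw (with_trivial n) (two_triangulations n) {F. two_triangulation n F}"
proof (rule bij_betw_byWitness[where f' = "\<lambda>F. F \<inter> nontrivial n"])
  show "\<forall>T \<in> two_triangulations n. with_trivial n T \<inter> nontrivial n = T"
    by (auto simp: two_triangulations_iff with_trivial_def)
  show "\<forall>F \<in> {F. two_triangulation n F}. with_trivial n (F \<inter> nontrivial n) = F"
    by (simp add: with_trivial_inter)
  show "with_trivial n ` two_triangulations n \<subseteq> {F. two_triangulation n F}"
    by (auto simp: two_triangulations_iff)
  show "(\<lambda>F. F \<inter> nontrivial n) ` {F. two_triangulation n F} \<subseteq> two_triangulations n"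
    by (auto simp: two_triangulations_def)
qed

lemma with_trivial_parent:
  assumes "T \<in> two_triangulations (n + 1)" "5 \<le> n"
  defines "G \<equiv> with_trivial (n + 1) T"
  shows "with_trivial n (triangulation_parent (n + 1) T) = contraction n (last_ear G + 1) G"
    and "triangulation_parent (n + 1) T \<in> two_triangulations n"
proof -
  have G: "two_triangulation (n + 1) G" "T = G \<inter> nontrivial (n + 1)"
    using assms(1) by (auto simp: two_triangulations_iff G_def with_trivial_def)
  obtain v where "apex n (last_ear G + 1) v G"
    using apex_exists[OF G(1) assms(2) refl] by blast
  then interpret apex n "last_ear G + 1" v G .
  have "triangulation_parent (n + 1) T = contraction n (last_ear G + 1) G \<inter> nontrivial n"
    using triangulation_parent_eq G(2) by simp
  moreover note two_triangulation_contraction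
  ultimately show "with_trivial n (triangulation_parent (n + 1) T) = contraction n (last_ear G + 1) G"
    and "triangulation_parent (n + 1) T \<in> two_triangulations n"
    by (auto simp: with_trivial_inter two_triangulations_def)
qed

lemma two_triangulations_5: "two_triangulations 5 = {{}}"
proof -
  have empty: "nontrivial 5 = {}" by (auto simp: nontrivial_iff)
  have "\<not> triple (diagonals 5) a b c a' b' c'" for a b c a' b' c'
  proof
    assume t: "triple (diagonals 5) a b c a' b' c'"
    then have "(a, a') \<in> diagonals 5" "(c, c') \<in> diagonals 5" by (auto simp: triple_def)
    then show False using triple_nontrivial[OF t, of 5] empty by (simp add: diagonals_iff)
  qed
  then have "two_triangulation 5 (diagonals 5)"
    by (simp add: two_triangulation_iff has_triple_def)
  then show ?thesis
    using empty by (auto simp: two_triangulations_def)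
qed

lemma tri_label_5: "tri_label 5 (with_trivial 5 {}) = [2, 1]"
proof -
  have F: "with_trivial 5 {} = {(1, 3), (1, 4), (2, 4), (2, 5), (3, 5)}"
    by (auto simp: with_trivial_def diagonals_iff nontrivial_iff)
  have "two_triangulation 5 (with_trivial 5 {})"
    using two_triangulations_5 two_triangulations_iff by blast
  from last_ear[OF this] have "last_ear (with_trivial 5 {}) = 2" by fastforce
  moreover have "{a. (a, 4) \<in> with_trivial 5 {}} = {1, 2}" "{a. (a, 3) \<in> with_trivial 5 {}} = {1}"
    unfolding F by auto
  ultimately show ?thesis by (simp add: tri_label_def upt_rec)
qed

lemma triangulation_levels:
  "labelled_levels (\<lambda>l. two_triangulations (l + 5)) (THE T. T \<in> two_triangulations 5)
     (\<lambda>l. triangulation_parent (l + 5)) (\<lambda>l T. tri_label (l + 5) (with_trivial (l + 5) T))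
     [2, 1] child_labels"
proof
  show root: "two_triangulations (0 + 5) = {THE T. T \<in> two_triangulations 5}"
    by (simp add: two_triangulations_5)
  show "tri_label (0 + 5) (with_trivial (0 + 5) (THE T. T \<in> two_triangulations 5)) = [2, 1]"
    by (simp add: two_triangulations_5 tri_label_5)
  show "triangulation_parent (Suc l + 5) T \<in> two_triangulations (l + 5)"
    if "T \<in> two_triangulations (Suc l + 5)" for T l
    using with_trivial_parent(2)[of T "l + 5"] that by simp
  show "bij_betw (\<lambda>T. tri_label (Suc l + 5) (with_trivial (Suc l + 5) T))
      {T \<in> two_triangulations (Suc l + 5). triangulation_parent (Suc l + 5) T = T'}
      (child_labels (tri_label (l + 5) (with_trivial (l + 5) T')))"
    if T': "T' \<in> two_triangulations (l + 5)" for l T'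
  proof -
    define n where "n = l + 5"
    have n: "5 \<le> n" "Suc l + 5 = n + 1" by (simp_all add: n_def)
    have T'n: "T' \<in> two_triangulations n" using T' by (simp add: n_def)
    let ?C = "{T \<in> two_triangulations (n + 1). triangulation_parent (n + 1) T = T'}"
    let ?D = "{G. two_triangulation (n + 1) G \<and>
      contraction n (last_ear G + 1) G = with_trivial n T'}"
    have inj: "triangulation_parent (n + 1) T = T' \<longleftrightarrow>
        contraction n (last_ear (with_trivial (n + 1) T) + 1) (with_trivial (n + 1) T) = with_trivial n T'"
      if "T \<in> two_triangulations (n + 1)" for T
      using with_trivial_parent[OF that n(1)] T'n bij_betw_with_trivial[of n]
      by (metis bij_betw_imp_inj_on inj_onD)
    have "bij_betw (with_trivial (n + 1)) ?C ?D"
    proof (rule bij_betw_subset[OF bij_betw_with_trivial])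
      show "with_trivial (n + 1) ` ?C = ?D"
      proof (intro equalityI subsetI)
        fix G assume G: "G \<in> ?D"
        then obtain T where "T \<in> two_triangulations (n + 1)" "G = with_trivial (n + 1) T"
          using bij_betw_imp_surj_on[OF bij_betw_with_trivial[of "n + 1"]] by blast
        then show "G \<in> with_trivial (n + 1) ` ?C" using G inj by blast
      next
        fix G assume "G \<in> with_trivial (n + 1) ` ?C"
        then obtain T where T: "T \<in> ?C" "G = with_trivial (n + 1) T" by blast
        then show "G \<in> ?D" using inj[of T] two_triangulations_iff[of T "n + 1"] by blast
      qed
    qed blast
    from bij_betw_trans[OF this tri_label_bij_betw]
    show ?thesis
      using T'n n by (simp add: two_triangulations_iff comp_def n_def)
  qed
qed

section \<open>Dyck paths and their exponents\<close>

text \<open>Exponents are numbered from the end of the path, so this counts the \<open>E\<close>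
  steps after the \<open>i\<close>-th last \<open>N\<close>, the final \<open>E\<close>
  excluded.\<close>

primrec psum :: "(nat \<Rightarrow> nat) \<Rightarrow> nat \<Rightarrow> nat" where
  "psum p 0 = 0"
| "psum p (Suc i) = psum p i + p (Suc i)"

lemma psum_eq_imp:
  assumes "\<And>i. 1 \<le> i \<Longrightarrow> i \<le> m \<Longrightarrow> psum p i = psum q i" "1 \<le> i" "i \<le> m"
  shows "p i = q i"
proof (cases i)
  case (Suc j)
  have "psum p j = psum q j" using assms(1)[of j] assms(3) Suc by (cases "j = 0") auto
  moreover have "psum p i = psum q i" using assms by blast
  ultimately show ?thesis using Suc by simp
qed (use assms in simp)

lemma path_of_0: "path_of 0 p = [E]"
  by (simp add: path_of_def)

lemma path_of_Suc: "path_of (Suc m) p = N # replicate (p (Suc m)) E @ path_of m p"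
  by (simp add: path_of_def)

lemma path_of_cong: "(\<And>i. 1 \<le> i \<Longrightarrow> i \<le> m \<Longrightarrow> p i = q i) \<Longrightarrow> path_of m p = path_of m q"
  by (induction m) (auto simp: path_of_0 path_of_Suc)

lemma length_path_of: "length (path_of m p) = m + 1 + psum p m"
  by (induction m) (auto simp: path_of_0 path_of_Suc)

lemma count_N_path_of: "count_list (path_of m p) N = m"
  by (induction m) (auto simp: path_of_0 path_of_Suc)

lemma count_E: "count_list w E + count_list w N = length w"
proof (induction w)
  case (Cons a w)
  then show ?case by (cases a) auto
qed simp

lemma count_list_le_take: "count_list (take j w) x \<le> count_list w x"
proof -
  have "count_list w x = count_list (take j w) x + count_list (drop j w) x"
    by (metis append_take_drop_id count_list_append)
  then show ?thesis by simp
qed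

text \<open>Read backwards, the \<open>i\<close>-th \<open>N\<close> comes after the final
  \<open>E\<close>, \<open>psum p i\<close> further \<open>E\<close> steps and \<open>i - 1\<close>
  steps \<open>N\<close>. This turns conditions on paths into conditions on partial sums.\<close>

lemma count_N_suffix:
  assumes "1 \<le> i" "i \<le> m"
  shows "i \<le> count_list (take j (rev (path_of m p))) N \<longleftrightarrow> i + 1 + psum p i \<le> j"
  using assms
proof (induction m)
  case 0
  then show ?case by simp
next
  case (Suc m)
  let ?w = "rev (path_of m p)" and ?a = "p (Suc m)"
  have len: "length ?w = m + 1 + psum p m" by (simp add: length_path_of)
  have le: "count_list (take j ?w) N \<le> m"
    using count_list_le_take[of j ?w N] by (simp add: count_N_path_of)
  have full: "count_list (take j ?w) N = m" if "m + 1 + psum p m \<le> j"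
    using that len by (simp add: count_N_path_of)
  have step: "count_list (take j (rev (path_of (Suc m) p))) N =
      count_list (take j ?w) N + (if m + 2 + psum p m + ?a \<le> j then 1 else 0)"
    using len by (simp add: path_of_Suc take_Cons split: nat.split)
  show ?case
  proof (cases "i = Suc m")
    case True
    then show ?thesis using step le full by auto
  next
    case False
    then have i: "i \<le> m" using Suc.prems by simp
    then have "i \<le> count_list (take j ?w) N \<longleftrightarrow> i + 1 + psum p i \<le> j"
      using Suc by blast
    then show ?thesis using step full i by auto
  qed
qed

lemma count_N_take:
  "count_list (take k w) N + count_list (take (length w - k) (rev w)) N = count_list w N"
proof -
  have "count_list (take (length w - k) (rev w)) N = count_list (drop k w) N"
    by (cases "k \<le> length w") (simp_all add: take_rev)
  then show ?thesis by (metis append_take_drop_id count_list_append)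
qed

text \<open>The totals of \<open>N\<close> and \<open>E\<close> agree, so a prefix has no excess of
  \<open>E\<close> exactly when the remaining suffix has no excess of \<open>N\<close>; suffixes
  suit the numbering from the end.\<close>

lemma dyck_path_iff:
  "dyck_path m w \<longleftrightarrow> length w = 2 * m \<and> count_list w N = m \<and>
     (\<forall>j. 2 * count_list (take j (rev w)) N \<le> j)"
proof (intro iffI conjI allI)
  assume w: "dyck_path m w"
  then show len: "length w = 2 * m" and cN: "count_list w N = m"
    using count_E[of w] by (auto simp: dyck_path_def)
  fix j
  show "2 * count_list (take j (rev w)) N \<le> j"
  proof (cases "j \<le> 2 * m")
    case True
    define k where "k = 2 * m - j"
    have "count_list (take k w) E \<le> count_list (take k w) N"
      using w by (simp add: dyck_path_def)
    then have "k \<le> 2 * count_list (take k w) N"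
      using count_E[of "take k w"] len by (simp add: k_def)
    then show ?thesis
      using count_N_take[of k w] True len cN by (simp add: k_def)
  next
    case False
    then show ?thesis using len cN by simp
  qed
next
  assume w: "length w = 2 * m \<and> count_list w N = m \<and>
     (\<forall>j. 2 * count_list (take j (rev w)) N \<le> j)"
  have "count_list (take k w) E \<le> count_list (take k w) N" for k
  proof (cases "k \<le> 2 * m")
    case True
    have "2 * count_list (take (2 * m - k) (rev w)) N \<le> 2 * m - k" using w by blast
    then show ?thesis
      using count_N_take[of k w] count_E[of "take k w"] w[THEN conjunct1]
        w[THEN conjunct2, THEN conjunct1] True by simp
  next
    case False
    then show ?thesis using w count_E[of w] by simp
  qed
  then show "dyck_path m w" using w count_E[of w] by (simp add: dyck_path_def)
qed

lemma never_below_iff: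
  assumes "length P = length Q" "count_list P N = count_list Q N"
  shows "never_below P Q \<longleftrightarrow>
    (\<forall>j. count_list (take j (rev P)) N \<le> count_list (take j (rev Q)) N)"
  unfolding never_below_def
proof (intro iffI allI)
  fix j
  assume *: "\<forall>k. count_list (take k Q) N \<le> count_list (take k P) N"
  show "count_list (take j (rev P)) N \<le> count_list (take j (rev Q)) N"
  proof (cases "j \<le> length P")
    case True
    then show ?thesis
      using *[rule_format, of "length P - j"] count_N_take[of "length P - j" P]
        count_N_take[of "length P - j" Q] assms by simp
  qed (use assms in simp)
next
  fix k
  assume *: "\<forall>j. count_list (take j (rev P)) N \<le> count_list (take j (rev Q)) N"
  show "count_list (take k Q) N \<le> count_list (take k P) N"
    using *[rule_format, of "length P - k"] count_N_take[of k P] count_N_take[of k Q] assms by simp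
qed

section \<open>Pairs of Dyck paths as inequalities between partial sums\<close>

definition supported :: "nat \<Rightarrow> (nat \<Rightarrow> nat) \<Rightarrow> bool" where
  "supported m p \<longleftrightarrow> (\<forall>i. i < 1 \<or> m < i \<longrightarrow> p i = 0)"

text \<open>The total is \<open>m - 1\<close> since the final \<open>E\<close> is written
  separately. The Dyck bound for \<open>p\<close> and the total of \<open>q\<close> follow from the
  listed conditions.\<close>

definition exponent_pairs :: "nat \<Rightarrow> ((nat \<Rightarrow> nat) \<times> (nat \<Rightarrow> nat)) set" where
  "exponent_pairs m = {(p, q). supported m p \<and> supported m q \<and> psum p m + 1 = m \<and>
     (\<forall>i. psum q i \<le> psum p i) \<and> (\<forall>i. i \<le> m \<longrightarrow> i \<le> psum q i + 1)}"

lemma psum_beyond: "supported m p \<Longrightarrow> m \<le> i \<Longrightarrow> psum p i = psum p m"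
  by (induction i) (auto simp: supported_def le_Suc_eq)

lemma dyck_path_path_of:
  assumes "1 \<le> m"
  shows "dyck_path m (path_of m p) \<longleftrightarrow> psum p m + 1 = m \<and> (\<forall>i. i \<le> m \<longrightarrow> i \<le> psum p i + 1)"
proof -
  let ?c = "\<lambda>j. count_list (take j (rev (path_of m p))) N"
  have c: "?c j \<le> m" for j
    using count_list_le_take[of j "rev (path_of m p)" N] by (simp add: count_N_path_of)
  have "(\<forall>j. 2 * ?c j \<le> j) \<longleftrightarrow> (\<forall>i. i \<le> m \<longrightarrow> i \<le> psum p i + 1)"
  proof (intro iffI allI impI)
    fix i assume *: "\<forall>j. 2 * ?c j \<le> j" and i: "i \<le> m"
    show "i \<le> psum p i + 1"
      using i count_N_suffix[of i m "i + 1 + psum p i" p] *[rule_format, of "i + 1 + psum p i"]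
      by (cases "i = 0") auto
  next
    fix j assume *: "\<forall>i. i \<le> m \<longrightarrow> i \<le> psum p i + 1"
    show "2 * ?c j \<le> j"
      using count_N_suffix[of "?c j" m j p] *[rule_format, of "?c j"] c[of j]
      by (cases "?c j = 0") auto
  qed
  then show ?thesis
    unfolding dyck_path_iff length_path_of count_N_path_of by auto
qed

lemma never_below_path_of:
  assumes "psum p m = psum q m"
  shows "never_below (path_of m p) (path_of m q) \<longleftrightarrow> (\<forall>i. i \<le> m \<longrightarrow> psum q i \<le> psum p i)"
proof -
  let ?c = "\<lambda>p j. count_list (take j (rev (path_of m p))) N"
  have c: "?c p j \<le> m" for p j
    using count_list_le_take[of j "rev (path_of m p)" N] by (simp add: count_N_path_of)
  have "never_below (path_of m p) (path_of m q) \<longleftrightarrow> (\<forall>j. ?c p j \<le> ?c q j)"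
    using assms by (intro never_below_iff) (simp_all add: length_path_of count_N_path_of)
  also have "\<dots> \<longleftrightarrow> (\<forall>i. i \<le> m \<longrightarrow> psum q i \<le> psum p i)"
  proof (intro iffI allI impI)
    fix i assume *: "\<forall>j. ?c p j \<le> ?c q j" and i: "i \<le> m"
    show "psum q i \<le> psum p i"
    proof (cases "i = 0")
      case False
      then have "i \<le> ?c p (i + 1 + psum p i)" using count_N_suffix[of i m _ p] i by auto
      then have "i \<le> ?c q (i + 1 + psum p i)" using * le_trans by blast
      then show ?thesis using count_N_suffix[of i m _ q] i False by auto
    qed simp
  next
    fix j assume *: "\<forall>i. i \<le> m \<longrightarrow> psum q i \<le> psum p i"
    define i where "i = ?c p j"
    have i: "i \<le> m" using c by (simp add: i_def)
    show "?c p j \<le> ?c q j"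
    proof (cases "i = 0")
      case False
      then have "i + 1 + psum p i \<le> j" using count_N_suffix[of i m j p] i by (simp add: i_def)
      then have "i + 1 + psum q i \<le> j" using * i by (meson add_le_mono le_refl le_trans)
      then show ?thesis using count_N_suffix[of i m j q] i False by (simp add: i_def)
    qed (simp add: i_def)
  qed
  finally show ?thesis .
qed

lemma path_of_inject:
  assumes "path_of m p = path_of m q" "supported m p" "supported m q"
  shows "p = q"
proof
  fix i
  have "psum p j = psum q j" if "1 \<le> j" "j \<le> m" for j
    using count_N_suffix[of j m _ p] count_N_suffix[of j m _ q] that assms(1)
    by (metis add_left_cancel le_antisym le_refl)
  then have "p i = q i" if "1 \<le> i" "i \<le> m" using psum_eq_imp that by blast
  moreover have "p i = q i" if "\<not> (1 \<le> i \<and> i \<le> m)"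
    using that assms(2,3) unfolding supported_def by (metis not_le)
  ultimately show "p i = q i" by blast
qed

lemma exponents_path_of: "supported m p \<Longrightarrow> exponents m (path_of m p) = p"
  unfolding exponents_def supported_def[symmetric]
  by (rule the_equality) (auto dest: path_of_inject)

text \<open>Stated for arbitrary words so that induction works: the leading block of
  \<open>a\<close> steps \<open>E\<close> becomes an exponent once an \<open>N\<close> is put in
  front.\<close>

lemma path_of_decomposition:
  "\<exists>a p. supported (count_list w N) p \<and> w @ [E] = replicate a E @ path_of (count_list w N) p"
proof (induction w)
  case Nil
  show ?case by (intro exI[of _ 0] exI[of _ "\<lambda>_. 0"]) (simp add: path_of_0 supported_def)
next
  case (Cons x w)
  let ?m = "count_list w N"
  obtain a p where p: "supported ?m p" "w @ [E] = replicate a E @ path_of ?m p"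
    using Cons by blast
  show ?case
  proof (cases x)
    case E
    then show ?thesis using p by (intro exI[of _ "Suc a"] exI[of _ p]) simp
  next
    case N
    define p' where "p' = p(Suc ?m := a)"
    have "path_of ?m p' = path_of ?m p" by (rule path_of_cong) (simp add: p'_def)
    then have "path_of (Suc ?m) p' = N # w @ [E]" using p(2) by (simp add: path_of_Suc p'_def)
    moreover have "supported (Suc ?m) p'" using p(1) by (simp add: supported_def p'_def)
    ultimately show ?thesis
      using N by (intro exI[of _ 0] exI[of _ p']) simp
  qed
qed

lemma dyck_path_is_path_of:
  assumes w: "dyck_path m w" and m: "1 \<le> m"
  shows "\<exists>p. supported m p \<and> w = path_of m p"
proof -
  have "w \<noteq> []" using w m by (auto simp: dyck_path_def)
  then obtain w' x where w': "w = w' @ [x]" by (metis rev_exhaust)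
  have "2 * count_list (take 1 (rev w)) N \<le> 1" using w unfolding dyck_path_iff by blast
  then have x: "x = E" using w' by (cases x) auto
  have "count_list w' N = m" using w w' x by (simp add: dyck_path_def)
  then obtain a p where p: "supported m p" "w = replicate a E @ path_of m p"
    using path_of_decomposition[of w'] w' x by auto
  have "count_list (take 1 w) E \<le> count_list (take 1 w) N" using w by (simp add: dyck_path_def)
  then have "a = 0" using p(2) by (cases a) auto
  then show ?thesis using p by auto
qed

lemma bij_betw_path_of:
  assumes m: "1 \<le> m"
  shows "bij_betw (\<lambda>(p, q). (path_of m p, path_of m q)) (exponent_pairs m) (dyck_pairs m)"
proof (rule bij_betw_imageI)
  show "inj_on (\<lambda>(p, q). (path_of m p, path_of m q)) (exponent_pairs m)"
    by (auto simp: inj_on_def exponent_pairs_def dest: path_of_inject)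
  have iff: "(path_of m p, path_of m q) \<in> dyck_pairs m \<longleftrightarrow> (p, q) \<in> exponent_pairs m"
    if s: "supported m p" "supported m q" for p q
  proof
    assume "(path_of m p, path_of m q) \<in> dyck_pairs m"
    then have *: "psum p m + 1 = m" "psum q m + 1 = m" "\<forall>i. i \<le> m \<longrightarrow> i \<le> psum q i + 1"
      and "never_below (path_of m p) (path_of m q)"
      using dyck_path_path_of[OF m] by (auto simp: dyck_pairs_def)
    moreover have "psum p m = psum q m" using *(1,2) by simp
    ultimately have le: "\<forall>i. i \<le> m \<longrightarrow> psum q i \<le> psum p i"
      using never_below_path_of by blast
    have "psum q i \<le> psum p i" for i
      using le psum_beyond[OF s(1), of i] psum_beyond[OF s(2), of i] by (cases "i \<le> m") auto
    then show "(p, q) \<in> exponent_pairs m" using * s by (simp add: exponent_pairs_def)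
  next
    assume pq: "(p, q) \<in> exponent_pairs m"
    then have *: "psum p m + 1 = m" "\<forall>i. psum q i \<le> psum p i" "\<forall>i. i \<le> m \<longrightarrow> i \<le> psum q i + 1"
      by (simp_all add: exponent_pairs_def)
    then have "m \<le> psum q m + 1" "psum q m \<le> psum p m" by simp_all
    then have q: "psum q m + 1 = m" using *(1) by simp
    have "\<forall>i. i \<le> m \<longrightarrow> i \<le> psum p i + 1"
      using *(2,3) by (meson add_le_mono le_refl le_trans)
    then show "(path_of m p, path_of m q) \<in> dyck_pairs m"
      using * q dyck_path_path_of[OF m] never_below_path_of[of p m q] by (simp add: dyck_pairs_def)
  qed
  show "(\<lambda>(p, q). (path_of m p, path_of m q)) ` exponent_pairs m = dyck_pairs m"
  proof (intro equalityI subsetI)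
    fix d assume "d \<in> (\<lambda>(p, q). (path_of m p, path_of m q)) ` exponent_pairs m"
    then obtain p q where "(p, q) \<in> exponent_pairs m" "d = (path_of m p, path_of m q)" by auto
    then show "d \<in> dyck_pairs m" using iff[of p q] by (auto simp: exponent_pairs_def)
  next
    fix d assume d: "d \<in> dyck_pairs m"
    obtain P Q where PQ: "d = (P, Q)" by (cases d)
    obtain p q where pq: "supported m p" "P = path_of m p" "supported m q" "Q = path_of m q"
      using dyck_path_is_path_of[OF _ m] d PQ unfolding dyck_pairs_def by blast
    then have "(p, q) \<in> exponent_pairs m" using iff d PQ by blast
    then show "d \<in> (\<lambda>(p, q). (path_of m p, path_of m q)) ` exponent_pairs m"
      using PQ pq by force
  qed
qed

section \<open>Children of a pair of Dyck paths\<close>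

definition split_index :: "(nat \<Rightarrow> nat) \<Rightarrow> (nat \<Rightarrow> nat) \<Rightarrow> nat" where
  "split_index p q = (LEAST j. 2 \<le> j \<and> p j * q j = 0)"

definition parent_p :: "nat \<Rightarrow> (nat \<Rightarrow> nat) \<Rightarrow> nat \<Rightarrow> nat" where
  "parent_p s p = (\<lambda>i. if i \<le> s - 2 then p i else if i = s - 1 then p (s - 1) - 1
     else if i = s then p s + p (s + 1) else p (i + 1))"

definition parent_q :: "nat \<Rightarrow> (nat \<Rightarrow> nat) \<Rightarrow> nat \<Rightarrow> nat" where
  "parent_q s q = (\<lambda>i. if i \<le> s - 2 then q i else if i = s - 1 then q (s - 1) + q s - 1
     else q (i + 1))"

text \<open>The pair with parent \<open>(p, q)\<close> and \<open>s = c + 2\<close> is determined by the sum \<open>x\<close> of its entries \<open>p\<^sub>s\<close> and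
  \<open>q\<^sub>s\<^sub>-\<^sub>1\<close>: since one of \<open>p\<^sub>s\<close>, \<open>q\<^sub>s\<close> vanishes, the amount \<open>x\<close> fills \<open>q\<^sub>s\<^sub>-\<^sub>1\<close> first, and only the excess
  \<open>z = x - (q\<^sub>s\<^sub>-\<^sub>1 + 1)\<close> (truncated, with \<open>q\<close> of the parent) goes to \<open>p\<^sub>s\<close>.\<close>

definition child_p :: "nat \<Rightarrow> nat \<Rightarrow> (nat \<Rightarrow> nat) \<Rightarrow> nat \<Rightarrow> nat" where
  "child_p c z p = (\<lambda>i. if i \<le> c then p i else if i = c + 1 then p (c + 1) + 1
     else if i = c + 2 then z else if i = c + 3 then p (c + 2) - z else p (i - 1))"

definition child_q :: "nat \<Rightarrow> nat \<Rightarrow> (nat \<Rightarrow> nat) \<Rightarrow> nat \<Rightarrow> nat" where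
  "child_q c x q = (\<lambda>i. if i \<le> c then q i else if i = c + 1 then min x (q (c + 1) + 1)
     else if i = c + 2 then q (c + 1) + 1 - x else q (i - 1))"

text \<open>Entry \<open>j\<close> is the number of admissible sums \<open>x\<close> for a child
  with \<open>s = j + 2\<close>. They run up to \<open>p (j + 2) + q (j + 1) + 1\<close>, starting
  at 0 if \<open>j = 0\<close> and at 1 otherwise, whence the summands 2 and 1.\<close>

definition dyck_label :: "(nat \<Rightarrow> nat) \<Rightarrow> (nat \<Rightarrow> nat) \<Rightarrow> nat list" where
  "dyck_label p q =
     map (\<lambda>j. p (j + 2) + q (j + 1) + (if j = 0 then 2 else 1)) [0..<split_index p q]"

lemma supportedD: "supported m p \<Longrightarrow> m < i \<Longrightarrow> p i = 0" "supported m p \<Longrightarrow> p 0 = 0"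
  by (auto simp: supported_def)

lemma split_index:
  assumes "supported m p" "1 \<le> m"
  shows "2 \<le> split_index p q" "split_index p q \<le> m + 1"
    "p (split_index p q) * q (split_index p q) = 0"
    "2 \<le> j \<Longrightarrow> j < split_index p q \<Longrightarrow> 0 < p j \<and> 0 < q j"
proof -
  let ?P = "\<lambda>j. 2 \<le> j \<and> p j * q j = 0"
  have P: "?P (m + 1)" using assms by (simp add: supportedD)
  have "?P (split_index p q)" unfolding split_index_def using P by (rule LeastI)
  then show "2 \<le> split_index p q" "p (split_index p q) * q (split_index p q) = 0" by simp_all
  show "split_index p q \<le> m + 1" unfolding split_index_def using P by (rule Least_le)
  show "0 < p j \<and> 0 < q j" if "2 \<le> j" "j < split_index p q"
    using not_less_Least[of j ?P] that unfolding split_index_def by auto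
qed

lemma split_index_eqI:
  assumes "2 \<le> s" "p s * q s = 0" "\<And>j. 2 \<le> j \<Longrightarrow> j < s \<Longrightarrow> 0 < p j \<and> 0 < q j"
  shows "split_index p q = s"
  unfolding split_index_def
proof (rule Least_equality)
  show "s \<le> j" if "2 \<le> j \<and> p j * q j = 0" for j
    using that assms(3)[of j] by (cases "j < s") auto
qed (use assms in auto)

text \<open>Merging the entries at \<open>s\<close> and \<open>s + 1\<close> skips one partial sum,
  here that at \<open>s = c + 2\<close>; for \<open>q\<close> it is that at \<open>s - 1\<close>.
  The lost unit stands on the left to avoid truncated subtraction.\<close>

lemma psum_parent_p:
  assumes "1 \<le> p (c + 1)"
  shows "psum (parent_p (c + 2) p) i + (if c + 1 \<le> i then 1 else 0) =
    psum p (if i \<le> c + 1 then i else i + 1)"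
proof (induction i)
  case (Suc i)
  have val: "parent_p (c + 2) p (Suc i) = (if i < c then p (Suc i) else if i = c then p (c + 1) - 1
      else if i = c + 1 then p (c + 2) + p (c + 3) else p (i + 2))"
    by (simp add: parent_p_def numeral_eq_Suc)
  consider "i < c" | "i = c" | "i = c + 1" | "c + 1 < i" by linarith
  then show ?case using val Suc assms by cases (simp_all add: numeral_eq_Suc)
qed simp

lemma psum_parent_q:
  assumes "1 \<le> q (c + 1) + q (c + 2)"
  shows "psum (parent_q (c + 2) q) i + (if c + 1 \<le> i then 1 else 0) =
    psum q (if i \<le> c then i else i + 1)"
proof (induction i)
  case (Suc i)
  have val: "parent_q (c + 2) q (Suc i) = (if i < c then q (Suc i) else
      if i = c then q (c + 1) + q (c + 2) - 1 else q (i + 2))"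
    by (simp add: parent_q_def numeral_eq_Suc)
  consider "i < c" | "i = c" | "c < i" by linarith
  then show ?case using val Suc assms by cases (simp_all add: numeral_eq_Suc)
qed simp

lemma psum_child_p:
  assumes "z \<le> p (c + 2)"
  shows "psum (child_p c z p) i =
    (if i \<le> c then psum p i else if i = c + 1 then psum p (c + 1) + 1
     else if i = c + 2 then psum p (c + 1) + 1 + z else psum p (i - 1) + 1)"
proof (induction i)
  case (Suc i)
  have val: "child_p c z p (Suc i) = (if i < c then p (Suc i) else if i = c then p (c + 1) + 1
      else if i = c + 1 then z else if i = c + 2 then p (c + 2) - z else p i)"
    by (simp add: child_p_def numeral_eq_Suc)
  have prev: "psum p i = psum p (i - 1) + p i" if "0 < i" using that by (cases i) auto
  consider "i < c" | "i = c" | "i = c + 1" | "i = c + 2" | "c + 2 < i" by linarith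
  then show ?case using val Suc assms prev by cases (simp_all add: numeral_eq_Suc)
qed simp

lemma psum_child_q:
  "psum (child_q c x q) i =
    (if i \<le> c then psum q i else if i = c + 1 then psum q c + min x (q (c + 1) + 1)
     else psum q (i - 1) + 1)"
proof (induction i)
  case (Suc i)
  have val: "child_q c x q (Suc i) = (if i < c then q (Suc i) else
      if i = c then min x (q (c + 1) + 1) else if i = c + 1 then q (c + 1) + 1 - x else q i)"
    by (simp add: child_q_def numeral_eq_Suc)
  have prev: "psum q i = psum q (i - 1) + q i" if "0 < i" using that by (cases i) auto
  consider "i < c" | "i = c" | "i = c + 1" | "c + 1 < i" by linarith
  then show ?case using val Suc prev by cases (simp_all add: numeral_eq_Suc)
qed simp

context
  fixes m :: nat and p q :: "nat \<Rightarrow> nat"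
  assumes m: "1 \<le> m" and pq: "(p, q) \<in> exponent_pairs m"
begin

lemma exponent_pairs_supported: "supported m p" "supported m q"
  and exponent_pairs_total: "psum p m + 1 = m"
  and exponent_pairs_le: "psum q i \<le> psum p i"
  and exponent_pairs_ge: "i \<le> m \<Longrightarrow> i \<le> psum q i + 1"
  using pq by (auto simp: exponent_pairs_def)

text \<open>For \<open>c > 0\<close> the bound \<open>1 \<le> x\<close> makes the entry of
  \<open>q'\<close> at \<open>c + 1\<close> positive, so that the split index is not reached too
  early; index 1 is never tested, so \<open>c = 0\<close> may use \<open>x = 0\<close>.\<close>

lemma child_in_exponent_pairs:
  fixes c x :: nat
  assumes c: "c < split_index p q" and x: "c = 0 \<or> 1 \<le> x" "x \<le> p (c + 2) + q (c + 1) + 1"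
  defines "z \<equiv> x - (q (c + 1) + 1)"
  defines "p' \<equiv> child_p c z p" and "q' \<equiv> child_q c x q"
  shows "(p', q') \<in> exponent_pairs (m + 1)" "split_index p' q' = c + 2"
    "parent_p (c + 2) p' = p" "parent_q (c + 2) q' = q"
proof -
  note s = split_index[OF exponent_pairs_supported(1) m, where q = q]
  have cm: "c \<le> m" using c s(2) by simp
  have z: "z \<le> p (c + 2)" using x by (simp add: z_def)
  have p': "p' i = (if i \<le> c then p i else if i = c + 1 then p (c + 1) + 1
     else if i = c + 2 then z else if i = c + 3 then p (c + 2) - z else p (i - 1))" for i
    by (simp add: p'_def child_p_def)
  have q': "q' i = (if i \<le> c then q i else if i = c + 1 then min x (q (c + 1) + 1)
     else if i = c + 2 then q (c + 1) + 1 - x else q (i - 1))" for i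
    by (simp add: q'_def child_q_def)
  have zero: "p i = 0" "q i = 0" if "m < i" for i
    using exponent_pairs_supported that by (auto simp: supportedD)
  \<comment> \<open>For \<open>c = m\<close> the formulas write to index \<open>m + 2\<close>,
    outside the support of the child; \<open>z = 0\<close> and \<open>1 \<le> x\<close> make these
    entries vanish.\<close>
  have z0: "z = 0" if "c = m"
    using z zero(1)[of "c + 2"] that by simp
  have x1: "1 \<le> x" if "c = m" using that x(1) m by auto
  have "p' i = 0" if "m + 1 < i" for i
    using that cm z0 zero(1) z unfolding p' by auto
  moreover have "q' i = 0" if "m + 1 < i" for i
    using that cm zero(2) x1 unfolding q' by auto
  moreover have "p' 0 = 0" "q' 0 = 0" using exponent_pairs_supported by (simp_all add: p' q' supportedD)
  ultimately have supp': "supported (m + 1) p'" "supported (m + 1) q'"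
    by (auto simp: supported_def)
  have sp: "psum p' i = (if i \<le> c then psum p i else if i = c + 1 then psum p (c + 1) + 1
     else if i = c + 2 then psum p (c + 1) + 1 + z else psum p (i - 1) + 1)" for i
    unfolding p'_def using z by (rule psum_child_p)
  have sq: "psum q' i = (if i \<le> c then psum q i
     else if i = c + 1 then psum q c + min x (q (c + 1) + 1) else psum q (i - 1) + 1)" for i
    unfolding q'_def by (rule psum_child_q)
  have "psum q' i \<le> psum p' i" for i
    using exponent_pairs_le[of i] exponent_pairs_le[of "i - 1"] exponent_pairs_le[of "c + 1"]
    unfolding sp sq by (auto simp: min_def)
  moreover have "i \<le> psum q' i + 1" if "i \<le> m + 1" for i
  proof -
    consider "i \<le> c" | "i = c + 1" | "c + 1 < i" by linarith
    then show ?thesis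
    proof cases
      case 1
      then show ?thesis using exponent_pairs_ge[of i] cm unfolding sq by simp
    next
      case 2
      then show ?thesis using exponent_pairs_ge[of c] cm x(1) unfolding sq by (auto simp: min_def)
    next
      case 3
      then obtain j where "i = Suc j" "c < j" by (cases i) auto
      then show ?thesis using exponent_pairs_ge[of j] that unfolding sq by simp
    qed
  qed
  moreover have "psum p' (m + 1) + 1 = m + 1"
  proof -
    have last: "psum p (m + 1) = psum p m" using zero(1) by simp
    consider "c = m" | "c + 1 = m" | "c + 1 < m" using cm by linarith
    then have "psum p' (m + 1) = psum p m + 1"
    proof cases
      case 2
      then have "z = 0" using z zero(1)[of "c + 2"] by simp
      then show ?thesis using 2 unfolding sp by simp
    qed (use last in \<open>simp_all only: sp, simp_all\<close>)
    then show ?thesis using exponent_pairs_total by simp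
  qed
  ultimately show "(p', q') \<in> exponent_pairs (m + 1)"
    using supp' by (simp add: exponent_pairs_def)
  show "split_index p' q' = c + 2"
  proof (rule split_index_eqI)
    \<comment> \<open>The factors are the opposite truncated differences of \<open>x\<close> and
      \<open>q (c + 1) + 1\<close>.\<close>
    show "p' (c + 2) * q' (c + 2) = 0" by (auto simp: p' q' z_def)
    fix j assume j: "2 \<le> j" "j < c + 2"
    show "0 < p' j \<and> 0 < q' j"
    proof (cases "j = c + 1")
      case True
      then show ?thesis using x(1) j by (auto simp: p' q')
    next
      case False
      then show ?thesis using s(4)[of j] c j by (simp add: p' q')
    qed
  qed simp
  show "parent_p (c + 2) p' = p"
  proof
    fix i
    have "parent_p (c + 2) p' i = (if i \<le> c then p' i else if i = c + 1 then p' (c + 1) - 1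
        else if i = c + 2 then p' (c + 2) + p' (c + 3) else p' (i + 1))"
      by (simp add: parent_p_def numeral_eq_Suc)
    then show "parent_p (c + 2) p' i = p i"
      using z by (auto simp: p')
  qed
  show "parent_q (c + 2) q' = q"
  proof
    fix i
    have "parent_q (c + 2) q' i = (if i \<le> c then q' i
        else if i = c + 1 then q' (c + 1) + q' (c + 2) - 1 else q' (i + 1))"
      by (simp add: parent_q_def numeral_eq_Suc)
    then show "parent_q (c + 2) q' i = q i"
      by (auto simp: q' min_def)
  qed
qed

text \<open>The shift from \<open>k\<close> to \<open>x\<close> starts the range at 0 for
  \<open>c = 0\<close> and at 1 otherwise. Entry \<open>c\<close> becomes \<open>k + 1\<close>
  because the two parts of \<open>x\<close> add up to \<open>x\<close>.\<close>

lemma dyck_label_child: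
  fixes c k :: nat
  assumes c: "c < split_index p q" and k: "1 \<le> k" "k \<le> dyck_label p q ! c"
  defines "x \<equiv> k + 1 - (if c = 0 then 2 else 1)"
  shows "c = 0 \<or> 1 \<le> x" "x \<le> p (c + 2) + q (c + 1) + 1"
    "dyck_label (child_p c (x - (q (c + 1) + 1)) p) (child_q c x q) =
       child_label (dyck_label p q) c k" (is "?D = _")
proof -
  have L: "dyck_label p q ! j = p (j + 2) + q (j + 1) + (if j = 0 then 2 else 1)"
    if "j \<le> c" for j using that c by (simp add: dyck_label_def)
  show x: "c = 0 \<or> 1 \<le> x" "x \<le> p (c + 2) + q (c + 1) + 1"
    using k L[of c] by (auto simp: x_def split: if_splits)
  have len: "split_index (child_p c (x - (q (c + 1) + 1)) p) (child_q c x q) = c + 2"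
    using c x by (rule child_in_exponent_pairs(2))
  show "?D = child_label (dyck_label p q) c k"
  proof (rule nth_equalityI)
    have lenD: "length ?D = c + 2" unfolding dyck_label_def len by simp
    then show "length ?D = length (child_label (dyck_label p q) c k)" by simp
    fix j assume "j < length ?D"
    then have j: "j < c + 2" unfolding lenD .
    have lhs: "?D ! j = child_p c (x - (q (c + 1) + 1)) p (j + 2) + child_q c x q (j + 1)
        + (if j = 0 then 2 else 1)"
      using j unfolding dyck_label_def len by (simp del: upt_Suc)
    have rhs: "child_label (dyck_label p q) c k ! j =
        (if j = c then k + 1 else if j = c + 1 then dyck_label p q ! c + 1 - k
         else if j + 1 = c then dyck_label p q ! j + 1 else dyck_label p q ! j)"
      using j by (simp add: child_label_def del: upt_Suc)
    consider "j = c" | "j = c + 1" | "j + 1 = c" | "j + 1 < c" using j by linarith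
    then show "?D ! j = child_label (dyck_label p q) c k ! j"
    proof cases
      case 1
      then show ?thesis unfolding lhs rhs using k(1)
        by (auto simp: child_p_def child_q_def x_def min_def)
    next
      case 2
      then show ?thesis unfolding lhs rhs using k L[of c]
        by (auto simp: child_p_def child_q_def x_def)
    next
      case 3
      then show ?thesis unfolding lhs rhs using L[of j]
        by (auto simp: child_p_def child_q_def)
    next
      case 4
      then show ?thesis unfolding lhs rhs using L[of j]
        by (auto simp: child_p_def child_q_def)
    qed
  qed
qed

end

section \<open>The tree of pairs of Dyck paths\<close>

text \<open>Besides membership, this exhibits every pair as a child of its parent, which gives
  surjectivity onto the children.\<close>

lemma parent_in_exponent_pairs:
  assumes m: "1 \<le> m" and pq: "(p, q) \<in> exponent_pairs (m + 1)"
    and s: "split_index p q = c + 2"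
  defines "P \<equiv> parent_p (c + 2) p" and "Q \<equiv> parent_q (c + 2) q"
  shows "(P, Q) \<in> exponent_pairs m"
    "\<exists>k. c < split_index P Q \<and> 1 \<le> k \<and> k \<le> dyck_label P Q ! c \<and>
      (let x = k + 1 - (if c = 0 then 2 else 1)
       in p = child_p c (x - (Q (c + 1) + 1)) P \<and> q = child_q c x Q)"
proof -
  have m': "1 \<le> m + 1" by simp
  note supp = exponent_pairs_supported[OF m' pq] and total = exponent_pairs_total[OF m' pq]
  note q_le_p = exponent_pairs_le[OF m' pq] and q_ge = exponent_pairs_ge[OF m' pq]
  note least = split_index[OF supp(1) m', where q = q, unfolded s]
  have zero: "p i = 0" "q i = 0" if "m + 1 < i" for i
    using supp that by (auto simp: supportedD)
  have cm: "c \<le> m" using least(2) by simp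
  have or: "p (c + 2) = 0 \<or> q (c + 2) = 0" using least(3) by simp
  have pos: "1 \<le> p (c + 1) \<and> 1 \<le> q (c + 1)" if "1 \<le> c"
    using least(4)[of "c + 1"] that by simp
  have q2: "1 \<le> q 1 + q 2"
    using q_ge[of 2] m supp(2) by (simp add: numeral_eq_Suc supportedD)
  have q1: "1 \<le> q (c + 1) + q (c + 2)"
    using pos q2 by (cases "c = 0") (auto simp: numeral_eq_Suc)
  \<comment> \<open>For \<open>c = 0\<close> positivity at \<open>s - 1 = 1\<close> is not part of
    the minimality of \<open>s\<close>; it comes from \<open>q 1 + q 2 \<ge> 1\<close>, the order of
    partial sums, and one of \<open>p 2\<close>, \<open>q 2\<close> being 0.\<close>
  have p1: "1 \<le> p (c + 1)"
  proof (cases "c = 0")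
    case True
    then have "p 2 = 0 \<or> q 2 = 0" using or by (simp add: numeral_eq_Suc)
    then show ?thesis
      using q_le_p[of 1] q_le_p[of 2] q2 supp True by (auto simp: numeral_eq_Suc supportedD)
  qed (use pos in simp)
  have P: "P i = (if i \<le> c then p i else if i = c + 1 then p (c + 1) - 1
        else if i = c + 2 then p (c + 2) + p (c + 3) else p (i + 1))" for i
    by (simp add: P_def parent_p_def numeral_eq_Suc)
  have Q: "Q i = (if i \<le> c then q i
        else if i = c + 1 then q (c + 1) + q (c + 2) - 1 else q (i + 1))" for i
    by (simp add: Q_def parent_q_def numeral_eq_Suc)
  have sP: "psum P i + (if c + 1 \<le> i then 1 else 0) = psum p (if i \<le> c + 1 then i else i + 1)" for i
    unfolding P_def using p1 by (rule psum_parent_p)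
  have sQ: "psum Q i + (if c + 1 \<le> i then 1 else 0) = psum q (if i \<le> c then i else i + 1)" for i
    unfolding Q_def using q1 by (rule psum_parent_q)
  have le: "psum Q i \<le> psum P i" for i
  proof -
    consider "i \<le> c" | "i = c + 1" | "c + 1 < i" by linarith
    then show ?thesis
    proof cases
      case 2
      \<comment> \<open>The one place where the order of the two paths could fail: at this index
        different partial sums of \<open>p\<close> and \<open>q\<close> are skipped, and
        \<open>p (c + 2) * q (c + 2) = 0\<close> closes the gap.\<close>
      have "psum q (c + 2) \<le> psum p (c + 1)"
        using or q_le_p[of "c + 1"] q_le_p[of "c + 2"] by auto
      then show ?thesis using sP[of i] sQ[of i] 2 by simp
    qed (use sP[of i] sQ[of i] q_le_p[of i] q_le_p[of "i + 1"] in \<open>simp_all del: psum.simps\<close>)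
  qed
  have ge: "i \<le> psum Q i + 1" if "i \<le> m" for i
    using sQ[of i] q_ge[of i] q_ge[of "i + 1"] that by (cases "i \<le> c") (simp_all del: psum.simps)
  have qm: "m \<le> psum q m + 1" "m \<le> psum q (m + 1)"
    using q_ge[of m] q_ge[of "m + 1"] by simp_all
  \<comment> \<open>Near the top the parent formulas reach index \<open>m + 1\<close>; the exact
    last entries are needed for the support and the total of the parent.\<close>
  have p_last: "p (m + 1) = (if c = m then 1 else 0)" if "m \<le> c + 1"
  proof (cases "c = m")
    case True
    then show ?thesis using pos m qm(1) q_le_p[of m] total by auto
  next
    case False
    then have "c + 2 = m + 1" using that cm by simp
    then have "p (m + 1) = 0 \<or> q (m + 1) = 0" using or by metis
    then show ?thesis using False qm(2) q_le_p[of m] total by auto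
  qed
  have q_last: "q (m + 1) \<le> 1" if "c = m"
    using qm q_le_p[of "m + 1"] total by simp
  have "psum P m + 1 = m"
  proof -
    consider "c = m" | "c + 1 = m" | "c + 1 < m" using cm by linarith
    then show ?thesis
      using sP[of m] total p_last by cases simp_all
  qed
  moreover have "supported m P"
    unfolding supported_def
  proof (intro allI impI)
    fix i assume i: "i < 1 \<or> m < i"
    then show "P i = 0"
    proof
      assume "i < 1"
      then show ?thesis using supp by (simp add: P supportedD)
    next
      assume i: "m < i"
      consider "c = m" | "c + 1 = m" | "c + 1 < m" using cm by linarith
      then show ?thesis
        using i p_last zero(1) by cases (auto simp: P)
    qed
  qed
  moreover have "supported m Q"
    unfolding supported_def
  proof (intro allI impI)
    fix i assume i: "i < 1 \<or> m < i"
    then show "Q i = 0"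
    proof
      assume "i < 1"
      then show ?thesis using supp by (simp add: Q supportedD)
    next
      assume i: "m < i"
      show ?thesis
        using i cm q_last zero(2) by (cases "c = m") (auto simp: Q)
    qed
  qed
  ultimately show PQ: "(P, Q) \<in> exponent_pairs m"
    using le ge by (simp add: exponent_pairs_def)
  \<comment> \<open>The sum of the entries \<open>p\<^sub>s\<close> and
    \<open>q\<^sub>s\<^sub>-\<^sub>1\<close> of the child, renumbered from 1.\<close>
  define x k where "x = p (c + 2) + q (c + 1)" and "k = x + (if c = 0 then 1 else 0)"
  have Ls: "c < split_index P Q"
  proof (rule ccontr)
    define j where "j = split_index P Q"
    assume "\<not> c < split_index P Q"
    then have "j \<le> c" by (simp add: j_def)
    moreover have "2 \<le> j" "P j * Q j = 0"
      using split_index[OF _ m, of P, where q = Q] PQ by (auto simp: j_def exponent_pairs_def)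
    ultimately show False using least(4)[of j] by (auto simp: P Q)
  qed
  have Qb: "Q (c + 1) + 1 = q (c + 1) + q (c + 2)" using q1 by (simp add: Q)
  have Pc: "P (c + 2) = p (c + 2) + p (c + 3)" by (simp add: P)
  have L: "dyck_label P Q ! c = P (c + 2) + Q (c + 1) + (if c = 0 then 2 else 1)"
    using Ls by (simp add: dyck_label_def)
  have "x \<le> P (c + 2) + Q (c + 1) + 1" unfolding x_def using Pc Qb by linarith
  then have "k \<le> dyck_label P Q ! c" unfolding L k_def by (cases "c = 0") simp_all
  moreover have "1 \<le> k" using pos by (cases "c = 0") (auto simp: k_def x_def)
  ultimately have k: "1 \<le> k" "k \<le> dyck_label P Q ! c" by simp_all
  have x: "k + 1 - (if c = 0 then 2 else 1) = x" by (simp add: k_def)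
  \<comment> \<open>Since \<open>p (c + 2)\<close> or \<open>q (c + 2)\<close> vanishes, comparing
    \<open>x\<close> with \<open>q (c + 1) + q (c + 2)\<close> recovers all three entries.\<close>
  have z: "x - (Q (c + 1) + 1) = p (c + 2)" "min x (Q (c + 1) + 1) = q (c + 1)"
    "Q (c + 1) + 1 - x = q (c + 2)"
    unfolding Qb x_def using or by auto
  have "p = child_p c (x - (Q (c + 1) + 1)) P"
  proof
    fix i
    show "p i = child_p c (x - (Q (c + 1) + 1)) P i"
      unfolding child_p_def z using p1 by (auto simp: P numeral_eq_Suc)
  qed
  moreover have "q = child_q c x Q"
  proof
    fix i
    show "q i = child_q c x Q i"
      unfolding child_q_def z by (auto simp: Q)
  qed
  ultimately show "\<exists>k. c < split_index P Q \<and> 1 \<le> k \<and> k \<le> dyck_label P Q ! c \<and>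
      (let x = k + 1 - (if c = 0 then 2 else 1)
       in p = child_p c (x - (Q (c + 1) + 1)) P \<and> q = child_q c x Q)"
    using Ls k x by (intro exI[of _ k]) (simp only: Let_def x simp_thms)
qed

definition parent_pair ::
    "(nat \<Rightarrow> nat) \<times> (nat \<Rightarrow> nat) \<Rightarrow> (nat \<Rightarrow> nat) \<times> (nat \<Rightarrow> nat)" where
  "parent_pair = (\<lambda>(p, q). (parent_p (split_index p q) p, parent_q (split_index p q) q))"

lemma split_index_cases:
  assumes "1 \<le> m" "(p, q) \<in> exponent_pairs m"
  obtains c where "split_index p q = c + 2"
proof -
  have "2 \<le> split_index p q"
    using assms by (intro split_index) (auto simp: exponent_pairs_def)
  then show thesis by (metis add.commute le_Suc_ex that)
qed

lemma dyck_label_bij_betw: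
  assumes m: "1 \<le> m" and PQ: "(P, Q) \<in> exponent_pairs m"
  shows "bij_betw (\<lambda>(p, q). dyck_label p q)
    {d \<in> exponent_pairs (m + 1). parent_pair d = (P, Q)} (child_labels (dyck_label P Q))"
    (is "bij_betw _ ?C _")
proof -
  let ?x = "\<lambda>c k :: nat. k + 1 - (if c = 0 then 2 else 1)"
  let ?child = "\<lambda>c k. (child_p c (?x c k - (Q (c + 1) + 1)) P, child_q c (?x c k) Q)"
  have L: "length (dyck_label P Q) = split_index P Q" by (simp add: dyck_label_def)
  have child: "?child c k \<in> ?C"
      "(\<lambda>(p, q). dyck_label p q) (?child c k) = child_label (dyck_label P Q) c k"
    if ck: "c < split_index P Q" "1 \<le> k" "k \<le> dyck_label P Q ! c" for c k
  proof -
    note d = dyck_label_child[OF m PQ ck]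
    show "?child c k \<in> ?C"
      using child_in_exponent_pairs[OF m PQ ck(1) d(1,2)]
      by (simp add: parent_pair_def del: add_2_eq_Suc' add_2_eq_Suc)
    show "(\<lambda>(p, q). dyck_label p q) (?child c k) = child_label (dyck_label P Q) c k"
      using d(3) by simp
  qed
  have ex: "\<exists>c k. c < split_index P Q \<and> 1 \<le> k \<and> k \<le> dyck_label P Q ! c \<and> d = ?child c k"
    if d: "d \<in> ?C" for d
  proof -
    obtain p q where pq: "d = (p, q)" by (cases d)
    then have in_C: "(p, q) \<in> exponent_pairs (m + 1)" "parent_pair (p, q) = (P, Q)"
      using d by auto
    obtain c where c: "split_index p q = c + 2"
      using split_index_cases[OF _ in_C(1)] by auto
    have "parent_p (c + 2) p = P" "parent_q (c + 2) q = Q"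
      using in_C(2) unfolding parent_pair_def prod.case c by simp_all
    then show ?thesis
      using parent_in_exponent_pairs(2)[OF m in_C(1) c] pq unfolding Let_def by blast
  qed
  show ?thesis
  proof (rule bij_betw_imageI)
    show "inj_on (\<lambda>(p, q). dyck_label p q) ?C"
    proof (rule inj_onI)
      fix d d' assume d: "d \<in> ?C" "d' \<in> ?C"
        and eq: "(\<lambda>(p, q). dyck_label p q) d = (\<lambda>(p, q). dyck_label p q) d'"
      obtain c k where ck: "c < split_index P Q" "1 \<le> k" "k \<le> dyck_label P Q ! c" "d = ?child c k"
        using ex[OF d(1)] by blast
      obtain c' k' where ck': "c' < split_index P Q" "1 \<le> k'" "k' \<le> dyck_label P Q ! c'"
        "d' = ?child c' k'"
        using ex[OF d(2)] by blast
      have "child_label (dyck_label P Q) c k = child_label (dyck_label P Q) c' k'"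
        using eq child(2)[OF ck(1-3)] child(2)[OF ck'(1-3)] unfolding ck(4) ck'(4) by argo
      then have "c = c'" "k = k'" by (rule child_label_inject)+
      then show "d = d'" unfolding ck(4) ck'(4) by blast
    qed
    show "(\<lambda>(p, q). dyck_label p q) ` ?C = child_labels (dyck_label P Q)"
    proof (intro equalityI subsetI)
      fix w assume "w \<in> (\<lambda>(p, q). dyck_label p q) ` ?C"
      then obtain d where d: "d \<in> ?C" "w = (\<lambda>(p, q). dyck_label p q) d" by blast
      obtain c k where ck: "c < split_index P Q" "1 \<le> k" "k \<le> dyck_label P Q ! c" "d = ?child c k"
        using ex[OF d(1)] by blast
      have "w = child_label (dyck_label P Q) c k"
        using d(2) child(2)[OF ck(1-3)] unfolding ck(4) by argo
      then show "w \<in> child_labels (dyck_label P Q)"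
        using ck(1-3) L unfolding child_labels_def by auto
    next
      fix w assume "w \<in> child_labels (dyck_label P Q)"
      then obtain c k where w: "w = child_label (dyck_label P Q) c k"
        and ck: "c < split_index P Q" "1 \<le> k" "k \<le> dyck_label P Q ! c"
        unfolding child_labels_def L by blast
      show "w \<in> (\<lambda>(p, q). dyck_label p q) ` ?C"
        unfolding w child(2)[OF ck, symmetric] using child(1)[OF ck] by (rule imageI)
    qed
  qed
qed

definition paths_of :: "nat \<Rightarrow> (nat \<Rightarrow> nat) \<times> (nat \<Rightarrow> nat) \<Rightarrow> step list \<times> step list" where
  "paths_of m = (\<lambda>(p, q). (path_of m p, path_of m q))"

lemma dyck_parent_paths_of:
  assumes "(p, q) \<in> exponent_pairs m"
  shows "dyck_parent m (paths_of m (p, q)) = paths_of (m - 1) (parent_pair (p, q))"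
proof -
  have exps: "exponents m (path_of m p) = p" "exponents m (path_of m q) = q"
    using assms by (auto simp: exponent_pairs_def exponents_path_of)
  show ?thesis
    unfolding dyck_parent_def paths_of_def parent_pair_def prod.case Let_def exps
      split_index_def[symmetric] parent_p_def parent_q_def ..
qed

lemma parent_pair_in:
  assumes "1 \<le> m" "d \<in> exponent_pairs (m + 1)"
  shows "parent_pair d \<in> exponent_pairs m"
proof -
  obtain p q where d: "d = (p, q)" by (cases d)
  obtain c where c: "split_index p q = c + 2"
    using split_index_cases[of "m + 1" p q] assms d by auto
  show ?thesis
    using parent_in_exponent_pairs(1)[OF assms(1) _ c] assms(2)
    unfolding d parent_pair_def prod.case c .
qed

definition dyck_pair_label :: "nat \<Rightarrow> step list \<times> step list \<Rightarrow> nat list" where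
  "dyck_pair_label m = (\<lambda>(P, Q). dyck_label (exponents m P) (exponents m Q))"

lemma dyck_pair_label_paths_of:
  "d \<in> exponent_pairs m \<Longrightarrow> dyck_pair_label m (paths_of m d) = (\<lambda>(p, q). dyck_label p q) d"
  by (auto simp: dyck_pair_label_def paths_of_def exponent_pairs_def exponents_path_of)

lemma exponent_pairs_1: "exponent_pairs 1 = {(\<lambda>_. 0, \<lambda>_. 0)}"
proof -
  have eq: "p = (\<lambda>_. 0)" if "supported 1 p" "p 1 = 0" for p
  proof
    show "p i = 0" for i
      using that supportedD(1)[OF that(1), of i] supportedD(2)[OF that(1)]
      by (cases i rule: linorder_cases[of _ 1]) auto
  qed
  have "d = (\<lambda>_. 0, \<lambda>_. 0)" if "d \<in> exponent_pairs 1" for d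
  proof -
    obtain p q where d: "d = (p, q)" "supported 1 p" "supported 1 q"
      "psum p 1 = 0" "\<forall>i. psum q i \<le> psum p i"
      using \<open>d \<in> exponent_pairs 1\<close> by (auto simp: exponent_pairs_def)
    then have "psum q 1 \<le> psum p 1" by blast
    then have "p 1 = 0" "q 1 = 0" using d(4) by simp_all
    then show ?thesis using d eq by blast
  qed
  moreover have "psum (\<lambda>_. 0) i = 0" for i by (induction i) auto
  then have "(\<lambda>_. 0, \<lambda>_. 0) \<in> exponent_pairs 1"
    by (simp add: exponent_pairs_def supported_def)
  ultimately show ?thesis by blast
qed

lemma dyck_levels:
  "labelled_levels (\<lambda>l. dyck_pairs (l + 1)) ([N, E], [N, E]) (\<lambda>l. dyck_parent (l + 1))
     (\<lambda>l. dyck_pair_label (l + 1)) [2, 1] child_labels"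
proof
  have bij: "bij_betw (paths_of m) (exponent_pairs m) (dyck_pairs m)" if "1 \<le> m" for m
    unfolding paths_of_def using that by (rule bij_betw_path_of)
  have img: "paths_of m ` exponent_pairs m = dyck_pairs m" if "1 \<le> m" for m
    using bij[OF that] by (rule bij_betw_imp_surj_on)
  have root: "paths_of 1 (\<lambda>_. 0, \<lambda>_. 0) = ([N, E], [N, E])"
    by (simp add: paths_of_def path_of_def)
  then show "dyck_pairs (0 + 1) = {([N, E], [N, E])}"
    using img[of 1] exponent_pairs_1 by simp
  have "split_index (\<lambda>_. 0) (\<lambda>_. 0) = 2" by (rule split_index_eqI) auto
  then show "dyck_pair_label (0 + 1) ([N, E], [N, E]) = [2, 1]"
    using dyck_pair_label_paths_of[of "(\<lambda>_. 0, \<lambda>_. 0)" 1] root exponent_pairs_1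
    by (simp add: dyck_label_def upt_rec)
  have par: "dyck_parent (Suc l + 1) (paths_of (Suc l + 1) d) = paths_of (l + 1) (parent_pair d)"
    if "d \<in> exponent_pairs (Suc l + 1)" for d l
    using dyck_parent_paths_of[of "fst d" "snd d" "Suc l + 1"] that by simp
  show "dyck_parent (Suc l + 1) D \<in> dyck_pairs (l + 1)" if D: "D \<in> dyck_pairs (Suc l + 1)" for D l
  proof -
    have "D \<in> paths_of (Suc l + 1) ` exponent_pairs (Suc l + 1)"
      using D by (subst img) simp_all
    then obtain d where d: "d \<in> exponent_pairs (Suc l + 1)" "D = paths_of (Suc l + 1) d"
      by blast
    have "parent_pair d \<in> exponent_pairs (l + 1)"
      using parent_pair_in[of "l + 1" d] d(1) by simp
    then show ?thesis
      unfolding d(2) par[OF d(1)] using img[of "l + 1"] by auto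
  qed
  show "bij_betw (dyck_pair_label (Suc l + 1))
      {D \<in> dyck_pairs (Suc l + 1). dyck_parent (Suc l + 1) D = D'}
      (child_labels (dyck_pair_label (l + 1) D'))"
    if D': "D' \<in> dyck_pairs (l + 1)" for l D'
  proof -
    define m where "m = l + 1"
    have m: "1 \<le> m" "Suc l + 1 = m + 1" "l + 1 = m" by (simp_all add: m_def)
    have "D' \<in> paths_of m ` exponent_pairs m"
      using D' unfolding img[OF m(1)] m .
    then obtain d' where d': "d' \<in> exponent_pairs m" "D' = paths_of m d'" by blast
    let ?C = "{d \<in> exponent_pairs (m + 1). parent_pair d = d'}"
    let ?D = "{D \<in> dyck_pairs (m + 1). dyck_parent (m + 1) D = D'}"
    have iff: "dyck_parent (m + 1) (paths_of (m + 1) d) = D' \<longleftrightarrow> parent_pair d = d'"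
      if d: "d \<in> exponent_pairs (m + 1)" for d
    proof -
      have "dyck_parent (m + 1) (paths_of (m + 1) d) = paths_of m (parent_pair d)"
        using par[of d l] d m by simp
      moreover have "parent_pair d \<in> exponent_pairs m" using m(1) d by (rule parent_pair_in)
      ultimately show ?thesis
        using bij_betw_imp_inj_on[OF bij[OF m(1)]] d' by (metis inj_onD)
    qed
    have image: "paths_of (m + 1) ` exponent_pairs (m + 1) = dyck_pairs (m + 1)"
      by (rule img) simp
    have C: "bij_betw (paths_of (m + 1)) ?C ?D"
    proof (rule bij_betw_subset[OF bij])
      show "paths_of (m + 1) ` ?C = ?D"
      proof (intro equalityI subsetI)
        fix D assume "D \<in> paths_of (m + 1) ` ?C"
        then show "D \<in> ?D" using iff image by blast
      next
        fix D assume D: "D \<in> ?D"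
        then obtain d where "d \<in> exponent_pairs (m + 1)" "D = paths_of (m + 1) d"
          using image by blast
        then show "D \<in> paths_of (m + 1) ` ?C" using iff[of d] D by blast
      qed
    qed auto
    have "bij_betw (\<lambda>(p, q). dyck_label p q) ?C (child_labels ((\<lambda>(p, q). dyck_label p q) d'))"
      using dyck_label_bij_betw[OF m(1), of "fst d'" "snd d'"] d'(1) by (simp add: case_prod_beta)
    then have "bij_betw (dyck_pair_label (m + 1) \<circ> paths_of (m + 1)) ?C
        (child_labels (dyck_pair_label m D'))"
      unfolding d'(2) dyck_pair_label_paths_of[OF d'(1)]
      by (subst bij_betw_cong) (auto simp: dyck_pair_label_paths_of)
    then have "bij_betw (dyck_pair_label (m + 1)) ?D (child_labels (dyck_pair_label m D'))"
      using bij_betw_comp_iff[OF C] by blast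
    then show ?thesis unfolding m .
  qed
qed

theorem theorem5p1:
  shows "rooted_tree triangulation_tree \<and> rooted_tree dyck_tree \<and>
         rtree_isomorphic triangulation_tree dyck_tree"
proof -
  note levels = triangulation_levels dyck_levels
  have "triangulation_tree = labelled_levels.tree (\<lambda>l. two_triangulations (l + 5))
      (THE T. T \<in> two_triangulations 5) (\<lambda>l. triangulation_parent (l + 5))"
    unfolding triangulation_tree_def labelled_levels.tree_def[OF levels(1)] ..
  moreover have "dyck_tree = labelled_levels.tree (\<lambda>l. dyck_pairs (l + 1)) ([N, E], [N, E])
      (\<lambda>l. dyck_parent (l + 1))"
    unfolding dyck_tree_def labelled_levels.tree_def[OF levels(2)] ..
  ultimately show ?thesis
    using labelled_levels.rooted_tree[OF levels(1)] labelled_levels.rooted_tree[OF levels(2)]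
      labelled_levels_isomorphic[OF levels] by simp
qed

end
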